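(* Let $f$ be a ring-like fully closed map from a non-empty compact space $X$ onto a first countable space $Y$ such that $\operatorname{Ind}_0f^{-1}(y)=\operatorname{Ind}_0f$ for every $y\in Y$. Then $\operatorname{Ind}_0X=\operatorname{Ind}_0Y+\operatorname{Ind}_0f$.
   Context: Conventions: a space is a regular $T_1$ topological space; compact spaces are Hausdorff; every map is continuous and closed. A map $f\colon X\to Y$ is ring-like if for every $x\in X$ and every pair of open sets $U\ni x$ in $X$ and $V\ni f(x)$ in $Y$, there is an open set $V'\ni f(x)$ in $Y$ such that $V'\subset V$ and $f^{-1}(\operatorname{bd}V')\subset U$, where $\operatorname{bd}$ denotes the boundary. A map $f\colon X\to Y$ is fully closed if for every pair of disjoint closed sets $F,G\subset X$, the intersection $f(F)\cap f(G)$ is a discrete subspace of $Y$. A partition in $X$ between disjoint sets $A,B\subset X$ is a closed set $L\subset X$ such that $X\setminus L=U\cup V$ with $U,V$ disjoint open subsets of $X$, $A\subset U$, $B\subset V$. A $G_\delta$ partition is a partition that is a $G_\delta$-subset of $X$. For a normal space $X$, $\operatorname{Ind}_0X\in\{-1,0,1,2,\ldots,\infty\}$ is defined by: $\operatorname{Ind}_0X=-1$ iff $X=\emptyset$; for $n\ge 0$, $\operatorname{Ind}_0X\le n$ iff between every two disjoint closed sets $A,B\subset X$ there is a $G_\delta$ partition $L$ in $X$ with $\operatorname{Ind}_0L\le n-1$; $\operatorname{Ind}_0X=n$ iff $\operatorname{Ind}_0X\le n$ and not $\operatorname{Ind}_0X\le n-1$; $\operatorname{Ind}_0X=\infty$ if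 $\operatorname{Ind}_0X\le n$ holds for no $n$. For a map $f\colon X\to Y$, $\operatorname{Ind}_0f=\sup\{\operatorname{Ind}_0f^{-1}(y)\colon y\in Y\}$. *)

theory Defs
  imports "HOL-Analysis.Analysis"
begin

definition ring_like :: "'a topology \<Rightarrow> 'b topology \<Rightarrow> ('a \<Rightarrow> 'b) \<Rightarrow> bool" where
  "ring_like X Y f \<longleftrightarrow>
     (\<forall>x\<in>topspace X. \<forall>U V. openin X U \<and> x \<in> U \<and> openin Y V \<and> f x \<in> V \<longrightarrow>
        (\<exists>V'. openin Y V' \<and> f x \<in> V' \<and> V' \<subseteq> V \<and>
              {z \<in> topspace X. f z \<in> Y frontier_of V'} \<subseteq> U))"

definition fully_closed :: "'a topology \<Rightarrow> 'b topology \<Rightarrow> ('a \<Rightarrow> 'b) \<Rightarrow> bool" where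
  "fully_closed X Y f \<longleftrightarrow>
     (\<forall>F G. closedin X F \<and> closedin X G \<and> disjnt F G \<longrightarrow>
        subtopology Y (f ` F \<inter> f ` G) = discrete_topology (f ` F \<inter> f ` G))"

definition partition_between :: "'a topology \<Rightarrow> 'a set \<Rightarrow> 'a set \<Rightarrow> 'a set \<Rightarrow> bool" where
  "partition_between X A B L \<longleftrightarrow>
     closedin X L \<and>
     (\<exists>U V. openin X U \<and> openin X V \<and> disjnt U V \<and> topspace X - L = U \<union> V \<and> A \<subseteq> U \<and> B \<subseteq> V)"

definition gdelta_partition_between :: "'a topology \<Rightarrow> 'a set \<Rightarrow> 'a set \<Rightarrow> 'a set \<Rightarrow> bool" where
  "gdelta_partition_between X A B L \<longleftrightarrow> partition_between X A B L \<and> gdelta_in X L"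

text \<open>
  \<open>Ind0_le X n\<close> is the relation \<open>Ind\<^sub>0 X \<le> n\<close>. It is meant for normal spaces, a class that
  is closed under passing to the closed subspaces \<open>L\<close>; no non-normal space satisfies it,
  since the partitions already separate disjoint closed sets.
\<close>
inductive Ind0_le :: "'a topology \<Rightarrow> int \<Rightarrow> bool" where
  empty: "topspace X = {} \<Longrightarrow> Ind0_le X (-1)"
| partition: "0 \<le> n \<Longrightarrow>
    (\<And>A B. closedin X A \<Longrightarrow> closedin X B \<Longrightarrow> disjnt A B \<Longrightarrow>
       \<exists>L. gdelta_partition_between X A B L \<and> Ind0_le (subtopology X L) (n - 1)) \<Longrightarrow>
    Ind0_le X n"

text \<open>
  The values lie in \<open>{-1, 0, 1, \<dots>, \<infinity>}\<close>; the infimum is attained if some bound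
  \<open>Ind0_le X n\<close> holds, and is \<open>\<infinity>\<close> otherwise (see \<open>Ind0_eq_iff\<close> and
  \<open>Ind0_eq_infinity_iff\<close> below).
\<close>
definition Ind0 :: "'a topology \<Rightarrow> ereal" where
  "Ind0 X = (INF n\<in>{n. Ind0_le X n}. ereal (of_int n))"

text \<open>The supremum is the intended one for nonempty \<open>Y\<close>; for empty \<open>Y\<close> it is \<open>-\<infinity>\<close>.\<close>
definition Ind0_map :: "'a topology \<Rightarrow> 'b topology \<Rightarrow> ('a \<Rightarrow> 'b) \<Rightarrow> ereal" where
  "Ind0_map X Y f = (SUP y\<in>topspace Y. Ind0 (subtopology X {x \<in> topspace X. f x = y}))"

lemma Ind0_le_ge: "Ind0_le X n \<Longrightarrow> -1 \<le> n"
  by (induction rule: Ind0_le.induct) auto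

lemma Ind0_le_minus_one_iff: "Ind0_le X (-1) \<longleftrightarrow> topspace X = {}"
  by (subst Ind0_le.simps) auto

lemma Ind0_le_iff:
  assumes "0 \<le> n"
  shows "Ind0_le X n \<longleftrightarrow>
    (\<forall>A B. closedin X A \<and> closedin X B \<and> disjnt A B \<longrightarrow>
       (\<exists>L. gdelta_partition_between X A B L \<and> Ind0_le (subtopology X L) (n - 1)))"
  using assms by (subst Ind0_le.simps) auto

lemma Ind0_le_Suc: "Ind0_le X n \<Longrightarrow> Ind0_le X (n + 1)"
proof (induction rule: Ind0_le.induct)
  case (empty X)
  show ?case
  proof (rule Ind0_le.partition)
    fix A B assume "closedin X A" "closedin X B"
    then have "A = {}" "B = {}"
      using empty closedin_subset by fastforce+
    moreover have "gdelta_in X {}"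
      by (metis empty gdelta_in_topspace)
    ultimately show "\<exists>L. gdelta_partition_between X A B L \<and> Ind0_le (subtopology X L) (-1 + 1 - 1)"
      using empty
      by (intro exI[of _ "{}"])
        (auto simp: gdelta_partition_between_def partition_between_def Ind0_le_minus_one_iff
          intro!: exI[of _ "{}"])
  qed simp
next
  case (partition n X)
  show ?case
    by (rule Ind0_le.partition) (use partition in \<open>fastforce+\<close>)
qed

lemma Ind0_le_mono:
  assumes "Ind0_le X m" "m \<le> n"
  shows "Ind0_le X n"
  using assms(2,1) by (induction rule: int_ge_induct) (auto intro: Ind0_le_Suc)

lemma Ind0_eq_infinity_iff: "Ind0 X = \<infinity> \<longleftrightarrow> (\<nexists>n. Ind0_le X n)"
proof
  assume inf: "Ind0 X = \<infinity>"
  have "Ind0 X \<le> ereal (of_int n)" if "Ind0_le X n" for n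
    unfolding Ind0_def using that by (intro INF_lower) auto
  with inf show "\<nexists>n. Ind0_le X n" by auto
qed (simp add: Ind0_def top_ereal_def)

lemma Ind0_eq_iff: "Ind0 X = ereal (of_int n) \<longleftrightarrow> Ind0_le X n \<and> \<not> Ind0_le X (n - 1)"
proof -
  have *: "Ind0 X = ereal (of_int k)" if "Ind0_le X k" "\<not> Ind0_le X (k - 1)" for k
  proof -
    have "k \<le> m" if "Ind0_le X m" for m
      using Ind0_le_mono[OF that, of "k - 1"] \<open>\<not> Ind0_le X (k - 1)\<close> by linarith
    then show ?thesis
      unfolding Ind0_def using that(1) by (intro antisym INF_lower2[of k] INF_greatest) auto
  qed
  show ?thesis
  proof
    assume eq: "Ind0 X = ereal (of_int n)"
    then obtain m where m: "Ind0_le X m"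
      using Ind0_eq_infinity_iff[of X] by auto
    obtain k where k: "Ind0_le X k" "\<not> Ind0_le X (k - 1)"
    proof -
      have "\<exists>k. Ind0_le X (int k - 1)"
        using m Ind0_le_ge[OF m] by (intro exI[of _ "nat (m + 1)"]) auto
      then have L: "Ind0_le X (int (LEAST k. Ind0_le X (int k - 1)) - 1)"
        by (rule LeastI_ex)
      show ?thesis
      proof (rule that[OF L], rule notI)
        let ?l = "LEAST k. Ind0_le X (int k - 1)"
        assume a: "Ind0_le X (int ?l - 1 - 1)"
        then have "?l \<ge> 1" using Ind0_le_ge[OF a] by linarith
        then have "Ind0_le X (int (?l - 1) - 1)" using a by (simp add: of_nat_diff)
        then have "?l \<le> ?l - 1" by (rule Least_le)
        with \<open>?l \<ge> 1\<close> show False by linarith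
      qed
    qed
    with *[OF k] eq show "Ind0_le X n \<and> \<not> Ind0_le X (n - 1)" by simp
  qed (use * in blast)
qed

lemma Ind0_eq_minus_one_iff: "Ind0 X = -1 \<longleftrightarrow> topspace X = {}"
  using Ind0_eq_iff[of X "-1"] Ind0_le_ge[of X "-2"]
  by (auto simp: Ind0_le_minus_one_iff one_ereal_def)

end

theory Submission
  imports Defs
begin

text \<open>
  Write \<open>f\<^sup>#(U)\<close> for the set of points whose whole fiber lies in \<open>U\<close>. Full closedness makes
  \<open>f(F) \<inter> f(G)\<close> finite for disjoint closed \<open>F\<close>, \<open>G\<close>, since \<open>Y\<close> is compact; outside such a
  finite set, partitions may be taken in \<open>Y\<close> instead of \<open>X\<close>.

  Upper bound: let \<open>A\<close>, \<open>B\<close> be disjoint and closed in \<open>X\<close>, and \<open>E = f(A) \<inter> f(B)\<close>. Choose a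
  partition \<open>T\<close> in the fibers over \<open>E\<close>, and neighborhoods \<open>V\<^sub>j\<close> of \<open>E\<close> shrinking to \<open>E\<close> whose
  boundaries have preimages near \<open>A\<close> (ring-likeness), so that no partition crosses them. In each
  annulus between \<open>V\<^sub>j\<close> and \<open>V\<^sub>j\<^sub>+\<^sub>1\<close> a partition \<open>M\<^sub>j\<close> can be pulled back from \<open>Y\<close>, forced ever
  closer to \<open>T\<close>. The union of \<open>T\<close> and all \<open>f\<^sup>-\<^sup>1(M\<^sub>j)\<close> is a partition in which the sets
  \<open>f\<^sup>-\<^sup>1(M\<^sub>j)\<close> are clopen, so its dimension is the largest of theirs and that of \<open>T\<close>.

  Lower bound: let \<open>L\<close> be a \<open>G\<^sub>\<delta>\<close> partition in \<open>X\<close> between the preimages of \<open>A\<close> and \<open>B\<close>, with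
  complement \<open>U \<union> V\<close>. As \<open>U\<close> and \<open>V\<close> are \<open>F\<^sub>\<sigma>\<close> sets, only countably many points lie outside
  \<open>f\<^sup>#(U) \<union> f\<^sup>#(V) \<union> f\<^sup>#(L)\<close>. They are swallowed by neighborhoods with boundary in \<open>f\<^sup>#(U)\<close> or in
  \<open>f\<^sup>#(V)\<close>; what remains is a partition \<open>M\<close> in \<open>Y\<close> with \<open>f\<^sup>-\<^sup>1(M) \<subseteq> L\<close>.
\<close>

subsection \<open>Extending partitions from a closed subspace\<close>

lemma normal_space_subset_shrink:
  assumes "normal_space X" "closedin X S" "closedin X C" "disjnt S C"
  obtains D where "closedin X D" "S \<subseteq> X interior_of D" "disjnt D C"
proof -
  have "openin X (topspace X - C)" "S \<subseteq> topspace X - C"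
    using assms closedin_subset by (auto simp: disjnt_iff)
  then obtain V where V: "openin X V" "S \<subseteq> V" "X closure_of V \<subseteq> topspace X - C"
    using assms unfolding normal_space_alt by metis
  show thesis
  proof
    show "closedin X (X closure_of V)" by simp
    show "S \<subseteq> X interior_of (X closure_of V)"
      using V by (meson closure_of_subset interior_of_maximal openin_subset order_trans)
    show "disjnt (X closure_of V) C" using V by (auto simp: disjnt_iff)
  qed
qed

text \<open>Serves in place of extending the partition \<open>T\<close> from \<open>Z\<close> to
  \<open>X\<close>. As \<open>T\<close> is a G-delta set in \<open>Z\<close>, its complement in
  \<open>Z\<close> is a countable union of closed sets \<open>C n\<close>, and each
  \<open>C n\<close> splits into a closed part in \<open>P\<close> and one in \<open>Q\<close>.
  Normality absorbs these parts one by one into growing disjoint closed sets that start from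
  \<open>A\<close> and \<open>B\<close>.\<close>

lemma partition_exhaustion:
  assumes norm: "normal_space X" and Z: "closedin X Z"
    and A: "closedin X A" and B: "closedin X B" and AB: "disjnt A B"
    and T: "gdelta_in (subtopology X Z) T"
    and P: "openin (subtopology X Z) P" and Q: "openin (subtopology X Z) Q" and PQ: "disjnt P Q"
    and ZT: "Z - T = P \<union> Q" and AP: "A \<inter> Z \<subseteq> P" and BQ: "B \<inter> Z \<subseteq> Q"
  obtains a b :: "nat \<Rightarrow> 'a set"
  where "\<And>j. closedin X (a j)" "\<And>j. closedin X (b j)" "a 0 = A" "b 0 = B"
    "\<And>j. a j \<subseteq> X interior_of (a (Suc j))" "\<And>j. b j \<subseteq> X interior_of (b (Suc j))"
    "\<And>j. disjnt (a j) (b j)" "Z \<inter> (\<Union>j. a j) = P" "Z \<inter> (\<Union>j. b j) = Q"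
proof -
  have Zt: "Z \<subseteq> topspace X" using Z closedin_subset by blast
  then have tZ: "topspace (subtopology X Z) = Z" by auto
  have "fsigma_in (subtopology X Z) (Z - T)"
    using T tZ by (metis gdelta_in_fsigma_in)
  then obtain C :: "nat \<Rightarrow> 'a set" where C: "\<And>n. closedin (subtopology X Z) (C n)" "(\<Union>n. C n) = Z - T"
    unfolding fsigma_in_ascending by blast
  have cl: "closedin X S" if "closedin (subtopology X Z) S" for S
    using that Z closedin_trans_full by blast
  have ZP: "closedin X (Z - P)" and ZQ: "closedin X (Z - Q)"
    using P Q cl closedin_diff[OF closedin_topspace[of "subtopology X Z"]] tZ by metis+
  have CQ: "closedin X (C n - Q)" and CP: "closedin X (C n - P)" for n
    using C(1)[of n] P Q by (auto intro!: cl closedin_diff)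
  have CQP: "C n - Q \<subseteq> P" "C n - P \<subseteq> Q" "C n \<subseteq> Z" for n
    using C(2) ZT by blast+
  define Inv where "Inv = (\<lambda>n (a,b). closedin X a \<and> closedin X b \<and> disjnt a b \<and> a \<inter> Z \<subseteq> P \<and> b \<inter> Z \<subseteq> Q
      \<and> (n = (0::nat) \<longrightarrow> a = A \<and> b = B))"
  define Stp where "Stp = (\<lambda>n (a,b) (a',b'). a \<union> (C n - Q) \<subseteq> X interior_of a' \<and> b \<union> (C n - P) \<subseteq> X interior_of b')"
  have "\<exists>g. \<forall>n. Inv n (g n) \<and> Stp n (g n) (g (Suc n))"
  proof (rule dependent_nat_choice)
    show "\<exists>x. Inv 0 x" unfolding Inv_def using A B AB AP BQ by (intro exI[of _ "(A,B)"]) auto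
  next
    fix x n assume "Inv n x"
    then obtain a b where x: "x = (a,b)" and I: "closedin X a" "closedin X b" "disjnt a b" "a \<inter> Z \<subseteq> P" "b \<inter> Z \<subseteq> Q"
      unfolding Inv_def by (cases x) auto
    \<comment> \<open>Avoiding \<open>Z - P\<close> keeps the trace of \<open>a'\<close> on
      \<open>Z\<close> inside \<open>P\<close>. The set \<open>b'\<close> is chosen second and has
      to avoid the new \<open>a'\<close>, not only the old \<open>a\<close>.\<close>
    have "disjnt (a \<union> (C n - Q)) (b \<union> (Z - P))"
      using I CQP[of n] PQ by (auto simp: disjnt_iff)
    then obtain a' where a': "closedin X a'" "a \<union> (C n - Q) \<subseteq> X interior_of a'" "disjnt a' (b \<union> (Z - P))"
      using normal_space_subset_shrink[OF norm, of "a \<union> (C n - Q)" "b \<union> (Z - P)"] I CQ ZP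
      by (metis closedin_Un)
    have "disjnt (b \<union> (C n - P)) (a' \<union> (Z - Q))"
      using I CQP[of n] PQ a' by (auto simp: disjnt_iff)
    then obtain b' where b': "closedin X b'" "b \<union> (C n - P) \<subseteq> X interior_of b'" "disjnt b' (a' \<union> (Z - Q))"
      using normal_space_subset_shrink[OF norm, of "b \<union> (C n - P)" "a' \<union> (Z - Q)"] I CP ZQ a'
      by (metis closedin_Un)
    show "\<exists>y. Inv (Suc n) y \<and> Stp n x y"
      unfolding Inv_def Stp_def x using a' b'
      by (intro exI[of _ "(a',b')"]) (auto simp: disjnt_iff)
  qed
  then obtain g where g: "\<And>n. Inv n (g n)" "\<And>n. Stp n (g n) (g (Suc n))" by blast
  define a where "a = fst \<circ> g"
  define b where "b = snd \<circ> g"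
  have I: "closedin X (a n)" "closedin X (b n)" "disjnt (a n) (b n)" "a n \<inter> Z \<subseteq> P" "b n \<inter> Z \<subseteq> Q" for n
    using g(1)[of n] by (auto simp: Inv_def a_def b_def split: prod.splits)
  have 0: "a 0 = A" "b 0 = B"
    using g(1)[of 0] by (auto simp: Inv_def a_def b_def split: prod.splits)
  have S: "a n \<union> (C n - Q) \<subseteq> X interior_of (a (Suc n))" "b n \<union> (C n - P) \<subseteq> X interior_of (b (Suc n))" for n
    using g(2)[of n] by (auto simp: Stp_def a_def b_def split: prod.splits)
  have "P \<subseteq> (\<Union>j. a j)"
  proof
    fix x assume "x \<in> P"
    then obtain n where "x \<in> C n - Q" using C(2) ZT PQ unfolding disjnt_iff by blast
    then show "x \<in> (\<Union>j. a j)" using S(1)[of n] interior_of_subset[of X "a (Suc n)"] by blast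
  qed
  moreover have "Q \<subseteq> (\<Union>j. b j)"
  proof
    fix x assume "x \<in> Q"
    then obtain n where "x \<in> C n - P" using C(2) ZT PQ unfolding disjnt_iff by blast
    then show "x \<in> (\<Union>j. b j)" using S(2)[of n] interior_of_subset[of X "b (Suc n)"] by blast
  qed
  ultimately show thesis
    using that[of a b] I S 0 ZT by blast
qed

text \<open>
  The annuli \<open>K j\<close> shrink to \<open>Z\<close>. Putting their boundaries into \<open>G\<close> makes the pieces \<open>M j\<close>
  clopen in the union; since \<open>a j\<close> and \<open>b j\<close> exhaust \<open>P\<close> and \<open>Q\<close>, the \<open>M j\<close> accumulate only at \<open>T\<close>.
\<close>
lemma glued_partition:
  fixes V W a b M G H :: "nat \<Rightarrow> 'a set"
  assumes V: "\<And>j. openin X (V j)" and W: "\<And>j. closedin X (W j)"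
    and VW: "\<And>j. V j \<subseteq> W j" and WV: "\<And>j. W (Suc j) \<subseteq> V j" and V0: "V 0 = topspace X"
    and Z: "Z = (\<Inter>j. V j)"
    and a: "\<And>j. a j \<subseteq> X interior_of (a (Suc j))" and b: "\<And>j. b j \<subseteq> X interior_of (b (Suc j))"
    and A: "closedin X (a 0)" and B: "closedin X (b 0)"
    and T: "gdelta_in (subtopology X Z) T" and ZT: "Z - T = P \<union> Q" and PQ: "disjnt P Q"
    and aP: "Z \<inter> (\<Union>j. a j) = P" and bQ: "Z \<inter> (\<Union>j. b j) = Q"
    and K: "\<And>j. K j = W j - V (Suc j)"
    and M: "\<And>j. gdelta_in (subtopology X (K j)) (M j)"
    and KM: "\<And>j. K j - M j = G j \<union> H j" and GH: "\<And>j. disjnt (G j) (H j)"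
    and G: "\<And>j. openin (subtopology X (K j)) (G j)" and H: "\<And>j. openin (subtopology X (K j)) (H j)"
    and aG: "\<And>j. a j \<inter> K j \<subseteq> G j" and bH: "\<And>j. b j \<inter> K j \<subseteq> H j"
    and bd1: "\<And>j. W j - V j \<subseteq> G j" and bd2: "\<And>j. W (Suc j) - V (Suc j) \<subseteq> G j"
  defines "L \<equiv> T \<union> (\<Union>j. M j)"
  shows "gdelta_partition_between X (a 0) (b 0) L"
    and "\<And>j. closedin X (M j)" and "\<And>j. openin (subtopology X L) (M j)"
    and "\<And>i j. i \<noteq> j \<Longrightarrow> disjnt (M i) (M j)" and "L - (\<Union>j. M j) = T"
proof -
  have Wt: "W j \<subseteq> topspace X" for j using W closedin_subset by blast
  have Kcl: "closedin X (K j)" for j unfolding K using V W by blast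
  have tK: "topspace (subtopology X (K j)) = K j" for j using Wt[of j] K by auto
  have Vanti: "V j \<subseteq> V i" if "i \<le> j" for i j
    using lift_Suc_antimono_le[of V i j] VW WV that by blast
  have WV': "W j \<subseteq> V i" if "i < j" for i j
    using Vanti[of i "j - 1"] WV[of "j - 1"] that by (cases j) auto
  have Zcl: "Z = (\<Inter>j. W j)" unfolding Z using VW WV by blast
  then have "closedin X Z" using W by (simp add: closedin_INT)
  have Zt: "Z \<subseteq> topspace X" using Z V0 by auto
  have tZ: "topspace (subtopology X Z) = Z" using Zt by auto
  have TZ: "T \<subseteq> Z" using gdelta_in_subset[OF T] tZ by blast
  have amono: "a i \<subseteq> a j" if "i \<le> j" for i j
    using lift_Suc_mono_le[of a i j] a that by (meson interior_of_subset order_trans)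
  have bmono: "b i \<subseteq> b j" if "i \<le> j" for i j
    using lift_Suc_mono_le[of b i j] b that by (meson interior_of_subset order_trans)
  \<comment> \<open>The annulus comes from the first index \<open>j0\<close> with \<open>x\<close>
    outside \<open>V j0\<close>; since \<open>V 0\<close> is the whole space, this index is a
    successor.\<close>
  have cover: "x \<in> Z \<or> (\<exists>j. x \<in> K j)" if x: "x \<in> topspace X" for x
  proof (cases "x \<in> Z")
    case False
    then obtain j where "x \<notin> V j" unfolding Z by auto
    define j0 where "j0 = (LEAST j. x \<notin> V j)"
    have "x \<notin> V j0" using \<open>x \<notin> V j\<close> unfolding j0_def by (rule LeastI)
    moreover have "j0 \<noteq> 0" using V0 x calculation by metis
    then obtain k where k: "j0 = Suc k" by (cases j0) auto
    have "x \<in> V k" using not_less_Least[of k "\<lambda>j. x \<notin> V j"] k j0_def by auto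
    ultimately show ?thesis using VW[of k] K[of k] k by auto
  qed simp
  have KZ: "K j \<inter> Z = {}" for j using K Z by auto
  have MK: "M j \<subseteq> K j" for j using gdelta_in_subset[OF M] tK by blast
  have GK: "G j \<subseteq> K j" "H j \<subseteq> K j" for j using KM[of j] by auto
  \<comment> \<open>\<open>I j\<close> is the annulus without its boundaries. By \<open>bd1\<close>
    and \<open>bd2\<close> the boundaries lie in \<open>G j\<close>, so \<open>M j\<close> and
    \<open>H j\<close> stay inside the open set \<open>I j\<close>, which meets no other
    annulus.\<close>
  define I where "I j = V j - W (Suc j)" for j
  have Iop: "openin X (I j)" for j unfolding I_def using V W by blast
  have IK: "I j \<subseteq> K j" for j unfolding I_def K using VW by blast
  have MI: "M j \<subseteq> I j" "H j \<subseteq> I j" for j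
    using bd1[of j] bd2[of j] KM[of j] GH[of j] MK[of j] GK[of j] K[of j] VW[of "Suc j"] VW[of j]
    unfolding I_def disjnt_iff by blast+
  have IKdis: "I i \<inter> K j = {}" if "i \<noteq> j" for i j
  proof (cases "i < j")
    case True
    then have "W j \<subseteq> W (Suc i)"
      using WV'[of "Suc i" j] VW[of "Suc i"] by (cases "j = Suc i") auto
    then show ?thesis unfolding I_def K by auto
  next
    case False
    then have "V i \<subseteq> V (Suc j)" using that Vanti[of "Suc j" i] by auto
    then show ?thesis unfolding I_def K by auto
  qed
  have HO: "openin X (H j)" for j
  proof -
    obtain R where R: "openin X R" "H j = R \<inter> K j" using H[of j] unfolding openin_subtopology by blast
    then have "H j = R \<inter> I j" using IK[of j] MI(2)[of j] by blast
    then show ?thesis using R Iop by auto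
  qed
  have KG: "closedin X (K j - G j)" for j
  proof -
    have "closedin (subtopology X (K j)) (K j - G j)"
      using G[of j] tK[of j] by (metis closedin_diff closedin_topspace)
    then show ?thesis using Kcl closedin_trans_full by blast
  qed
  have KGe: "K j - G j = M j \<union> H j" for j
    using KM[of j] GH[of j] MK[of j] by (auto simp: disjnt_iff)
  show Mcl: "closedin X (M j)" for j
  proof -
    have "M j = (K j - G j) - H j" using KGe[of j] KM[of j] by blast
    then show ?thesis using KG HO by (metis closedin_diff)
  qed
  show Mdis: "disjnt (M i) (M j)" if "i \<noteq> j" for i j
    using MI(1)[of i] MK[of j] IKdis[OF that] by (auto simp: disjnt_iff)
  have LI: "M j = L \<inter> I j" for j
  proof -
    have "M i \<inter> I j = {}" if "i \<noteq> j" for i using MK[of i] IKdis[of j i] that by auto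
    moreover have "T \<inter> I j = {}" using TZ IK[of j] KZ[of j] by auto
    moreover have "x \<in> M j" if "x \<in> M i" "x \<in> I j" for x i
      using that calculation(1)[of i] by (cases "i = j") auto
    ultimately show ?thesis using MI(1)[of j] unfolding L_def by auto
  qed
  show "openin (subtopology X L) (M j)" for j
    using LI Iop openin_subtopology_Int2 by metis
  show "L - (\<Union>j. M j) = T" using TZ MK KZ unfolding L_def by blast
  define U where "U = P \<union> (\<Union>j. G j)"
  define O' where "O' = Q \<union> (\<Union>j. H j)"
  have ZPQ: "P \<subseteq> Z" "Q \<subseteq> Z" "P \<inter> T = {}" "Q \<inter> T = {}" using ZT by auto
  have UL: "topspace X - L = U \<union> O'"
  proof
    show "topspace X - L \<subseteq> U \<union> O'"
    proof
      fix x assume x: "x \<in> topspace X - L"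
      then consider "x \<in> Z" | j where "x \<in> K j" using cover by blast
      then show "x \<in> U \<union> O'"
      proof cases
        case 1 then show ?thesis using x ZT unfolding L_def U_def O'_def by blast
      next
        case (2 j) then show ?thesis using x KM[of j] unfolding L_def U_def O'_def by blast
      qed
    qed
    have "K j \<subseteq> topspace X" for j using Kcl closedin_subset by blast
    then have "U \<union> O' \<subseteq> topspace X" using Zt ZPQ GK unfolding U_def O'_def by blast
    moreover have "x \<notin> L" if x: "x \<in> U \<union> O'" for x
    proof (cases "x \<in> Z")
      case True
      then show ?thesis using x ZPQ GK MK KZ unfolding L_def U_def O'_def by blast
    next
      case False
      then obtain j where j: "x \<in> G j \<union> H j" using x ZPQ unfolding U_def O'_def by blast
      show ?thesis
      proof
        assume "x \<in> L"
        then obtain i where i: "x \<in> M i" using False TZ unfolding L_def by blast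
        then have "i = j" using j MI(1)[of i] GK[of j] IKdis[of i j] by blast
        then show False using i j KM[of j] by blast
      qed
    qed
    ultimately show "U \<union> O' \<subseteq> topspace X - L" by auto
  qed
  have dis: "disjnt U O'"
  proof -
    have "G i \<inter> H j = {}" for i j
    proof (cases "i = j")
      case True then show ?thesis using GH[of i] by (auto simp: disjnt_iff)
    next
      case False then show ?thesis using MI(2)[of j] GK[of i] IKdis[of j i] by blast
    qed
    then show ?thesis using PQ ZPQ GK KZ unfolding U_def O'_def disjnt_iff by blast
  qed
  \<comment> \<open>Kept general in \<open>c\<close>, \<open>D\<close>, \<open>F\<close> to serve
    both sides of the partition. Apart from \<open>Z\<close>, the set \<open>V (Suc i)\<close> meets
    only annuli \<open>K j\<close> with \<open>j\<close> at least \<open>Suc i\<close>, and there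
    \<open>c (Suc i)\<close> is contained in \<open>c j\<close>, whose trace lies in
    \<open>F j\<close>.\<close>
  have nearZ: "\<exists>N. openin X N \<and> x \<in> N \<and> N \<subseteq> D \<union> (\<Union>j. F j)"
    if D: "x \<in> D" "Z \<inter> (\<Union>j. c j) = D" and c: "\<And>j. c j \<subseteq> X interior_of (c (Suc j))"
      and cF: "\<And>j. c j \<inter> K j \<subseteq> F j" and FK: "\<And>j. F j \<subseteq> K j" for x D and c F :: "nat \<Rightarrow> 'a set"
  proof -
    have cmono: "c i \<subseteq> c j" if "i \<le> j" for i j
      using lift_Suc_mono_le[of c i j] c that by (meson interior_of_subset order_trans)
    obtain i where i: "x \<in> c i" "x \<in> Z" using D by blast
    let ?N = "X interior_of (c (Suc i)) \<inter> V (Suc i)"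
    have "openin X ?N" using V by auto
    moreover have "x \<in> ?N" using i c Z by blast
    moreover have "?N \<subseteq> D \<union> (\<Union>j. F j)"
    proof
      fix y assume y: "y \<in> ?N"
      then have yc: "y \<in> c (Suc i)" using interior_of_subset by fastforce
      have "y \<in> topspace X" using y V openin_subset by blast
      then consider "y \<in> Z" | j where "y \<in> K j" using cover by blast
      then show "y \<in> D \<union> (\<Union>j. F j)"
      proof cases
        case 1 then show ?thesis using D yc by blast
      next
        case 2
        have "Suc i \<le> j"
        proof (rule ccontr)
          assume "\<not> Suc i \<le> j"
          then have "V (Suc i) \<subseteq> V (Suc j)" using Vanti[of "Suc j" "Suc i"] by auto
          then show False using 2 y K by auto
        qed
        then show ?thesis using cmono yc 2 cF by blast
      qed
    qed
    ultimately show ?thesis by blast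
  qed
  have "openin X O'"
  proof (subst openin_subopen, intro ballI)
    fix x assume x: "x \<in> O'"
    show "\<exists>N. openin X N \<and> x \<in> N \<and> N \<subseteq> O'"
    proof (cases "x \<in> Q")
      case True
      then show ?thesis unfolding O'_def using nearZ[OF _ bQ b bH GK(2)] by blast
    next
      case False
      then show ?thesis using x HO unfolding O'_def by blast
    qed
  qed
  moreover have "openin X U"
  proof (subst openin_subopen, intro ballI)
    fix x assume x: "x \<in> U"
    show "\<exists>N. openin X N \<and> x \<in> N \<and> N \<subseteq> U"
    proof (cases "x \<in> P")
      case True
      then show ?thesis unfolding U_def using nearZ[OF _ aP a aG GK(1)] by blast
    next
      case False
      then obtain k where k: "x \<in> G k" using x unfolding U_def by blast
      then have xk: "x \<notin> V (Suc k)" "x \<in> topspace X" using GK K Wt by blast+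
      then have xW: "x \<notin> W (Suc (Suc k))" using WV by blast
      \<comment> \<open>Unlike \<open>H j\<close>, the set \<open>G j\<close> contains the
        boundaries of its annulus and need not be open in \<open>X\<close>. Outside
        \<open>W (Suc (Suc k))\<close> only annuli of index at most \<open>Suc k\<close> occur, so
        removing finitely many closed sets \<open>K i - G i\<close> leaves an open set inside
        \<open>U\<close>.\<close>
      let ?N = "(topspace X - W (Suc (Suc k))) - (\<Union>i\<le>Suc k. K i - G i)"
      have "openin X ?N"
        using W KG by (intro openin_diff closedin_Union) auto
      moreover have "x \<in> ?N"
      proof -
        have "x \<notin> M i \<union> H i" for i
          using dis UL x unfolding L_def O'_def disjnt_iff by blast
        then show ?thesis using KGe xk xW by auto
      qed
      moreover have "?N \<subseteq> U"
      proof
        fix y assume y: "y \<in> ?N"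
        have "y \<notin> Z" using y Zcl by auto
        then obtain i where i: "y \<in> K i" using y cover by blast
        have "i \<le> Suc k"
        proof (rule ccontr)
          assume n: "\<not> i \<le> Suc k"
          then have "W i \<subseteq> W (Suc (Suc k))"
            using WV'[of "Suc (Suc k)" i] VW[of "Suc (Suc k)"] by (cases "i = Suc (Suc k)") auto
          then show False using i y K by auto
        qed
        then show "y \<in> U" using i y unfolding U_def by auto
      qed
      ultimately show ?thesis by blast
    qed
  qed
  moreover have "a 0 \<subseteq> U" "b 0 \<subseteq> O'"
  proof -
    show "a 0 \<subseteq> U"
    proof
      fix x assume x: "x \<in> a 0"
      then have "x \<in> topspace X" using A closedin_subset by blast
      then consider "x \<in> Z" | j where "x \<in> K j" using cover by blast
      then show "x \<in> U"
      proof cases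
        case 1 then show ?thesis using x aP unfolding U_def by blast
      next
        case (2 j)
        then have "x \<in> G j" using x amono[of 0 j] aG[of j] by blast
        then show ?thesis unfolding U_def by blast
      qed
    qed
    show "b 0 \<subseteq> O'"
    proof
      fix x assume x: "x \<in> b 0"
      then have "x \<in> topspace X" using B closedin_subset by blast
      then consider "x \<in> Z" | j where "x \<in> K j" using cover by blast
      then show "x \<in> O'"
      proof cases
        case 1 then show ?thesis using x bQ unfolding O'_def by blast
      next
        case (2 j)
        then have "x \<in> H j" using x bmono[of 0 j] bH[of j] by blast
        then show ?thesis unfolding O'_def by blast
      qed
    qed
  qed
  moreover have "closedin X L"
  proof -
    have "L \<subseteq> topspace X" using TZ Zt Mcl closedin_subset unfolding L_def by blast
    then have "L = topspace X - (U \<union> O')" using UL by blast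
    then show ?thesis using calculation by auto
  qed
  \<comment> \<open>The complement of \<open>L\<close> splits into the sets \<open>Z - T\<close> and
    \<open>K j - M j\<close>, each of them F-sigma in a closed subspace and hence in
    \<open>X\<close>.\<close>
  moreover have "gdelta_in X L"
  proof -
    have "fsigma_in X (K j - M j)" for j
    proof -
      have "fsigma_in (subtopology X (K j)) (K j - M j)" using M[of j] tK[of j] by (metis gdelta_in_fsigma_in)
      then show ?thesis using fsigma_in_fsigma_subtopology[OF closed_imp_fsigma_in[OF Kcl[of j]]] by blast
    qed
    moreover have "fsigma_in X (Z - T)"
    proof -
      have "fsigma_in (subtopology X Z) (Z - T)" using T tZ by (metis gdelta_in_fsigma_in)
      then show ?thesis using fsigma_in_fsigma_subtopology[OF closed_imp_fsigma_in[OF \<open>closedin X Z\<close>]] by blast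
    qed
    moreover have "topspace X - L = (Z - T) \<union> (\<Union>j. K j - M j)"
      unfolding UL U_def O'_def using ZT KM by blast
    ultimately have "fsigma_in X (topspace X - L)"
      by (auto intro!: fsigma_in_Un fsigma_in_Union)
    then show ?thesis using closedin_subset[OF \<open>closedin X L\<close>] gdelta_in_fsigma_in by blast
  qed
  ultimately show "gdelta_partition_between X (a 0) (b 0) L"
    unfolding gdelta_partition_between_def partition_between_def using UL dis by (intro conjI exI[of _ U] exI[of _ O'])
qed

subsection \<open>Closed subspaces and clopen sums\<close>

text \<open>The trace on \<open>F\<close> of a partition in \<open>X\<close> is a partition in
  \<open>F\<close> and is closed in the old partition, so induction on the derivation
  applies.\<close>

lemma Ind0_le_closed_subtopology:
  assumes "Ind0_le X n" "closedin X F"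
  shows "Ind0_le (subtopology X F) n"
  using assms
proof (induction arbitrary: F rule: Ind0_le.induct)
  case (empty X)
  then show ?case by (auto simp: Ind0_le_minus_one_iff)
next
  case (partition n X)
  show ?case
  proof (rule Ind0_le.partition[OF \<open>0 \<le> n\<close>])
    fix A B assume AB: "closedin (subtopology X F) A" "closedin (subtopology X F) B" "disjnt A B"
    then have "closedin X A" "closedin X B" "A \<subseteq> F" "B \<subseteq> F"
      using partition.prems closedin_trans_full closedin_imp_subset by blast+
    with AB partition.IH obtain L U V where L: "closedin X L" "gdelta_in X L"
      and UV: "openin X U" "openin X V" "disjnt U V" "topspace X - L = U \<union> V" "A \<subseteq> U" "B \<subseteq> V"
      and IH: "\<And>F. closedin (subtopology X L) F \<Longrightarrow> Ind0_le (subtopology (subtopology X L) F) (n - 1)"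
      unfolding gdelta_partition_between_def partition_between_def by metis
    have "closedin (subtopology X L) (L \<inter> F)"
      using partition.prems by (simp add: closedin_subtopology_Int_closed)
    from IH[OF this] have "Ind0_le (subtopology (subtopology X F) (F \<inter> L)) (n - 1)"
      by (simp add: subtopology_subtopology inf.commute inf.left_commute)
    moreover have "gdelta_partition_between (subtopology X F) A B (F \<inter> L)"
      unfolding gdelta_partition_between_def partition_between_def
    proof (intro conjI exI)
      show "closedin (subtopology X F) (F \<inter> L)" using L by (simp add: closedin_subtopology_Int_closed)
      show "gdelta_in (subtopology X F) (F \<inter> L)" unfolding gdelta_in_subtopology using L by blast
      show "openin (subtopology X F) (F \<inter> U)" "openin (subtopology X F) (F \<inter> V)"
        using UV by (auto simp: openin_subtopology_Int2)
    qed (use UV \<open>A \<subseteq> F\<close> \<open>B \<subseteq> F\<close> in \<open>auto simp: disjnt_iff\<close>)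
    ultimately show "\<exists>L. gdelta_partition_between (subtopology X F) A B L \<and> Ind0_le (subtopology (subtopology X F) L) (n - 1)"
      by blast
  qed
qed

text \<open>Unpacks the dimension bound of a closed subspace in terms of subsets of
  \<open>X\<close>, so that iterated subspaces disappear; \<open>A\<close> and \<open>B\<close> may
  meet outside \<open>K\<close>.\<close>

lemma Ind0_le_subspace_partition:
  assumes n: "Ind0_le (subtopology X K) n" "0 \<le> n" and K: "closedin X K"
    and AB: "closedin X A" "closedin X B" "A \<inter> B \<inter> K = {}"
  obtains M G H where "closedin X M" "M \<subseteq> K" "gdelta_in (subtopology X K) M"
    "openin (subtopology X K) G" "openin (subtopology X K) H" "disjnt G H" "K - M = G \<union> H"
    "A \<inter> K \<subseteq> G" "B \<inter> K \<subseteq> H" "Ind0_le (subtopology X M) (n - 1)"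
proof -
  have tK: "topspace (subtopology X K) = K" using closedin_subset[OF K] by auto
  have "closedin (subtopology X K) (A \<inter> K)" "closedin (subtopology X K) (B \<inter> K)" "disjnt (A \<inter> K) (B \<inter> K)"
    using AB by (auto simp: closedin_subtopology disjnt_iff)
  then obtain M where M: "gdelta_partition_between (subtopology X K) (A \<inter> K) (B \<inter> K) M"
    and Mn: "Ind0_le (subtopology (subtopology X K) M) (n - 1)"
    using n Ind0_le_iff by metis
  from M obtain G H where MG: "closedin (subtopology X K) M" "gdelta_in (subtopology X K) M"
    "openin (subtopology X K) G" "openin (subtopology X K) H" "disjnt G H" "K - M = G \<union> H"
    "A \<inter> K \<subseteq> G" "B \<inter> K \<subseteq> H"
    unfolding gdelta_partition_between_def partition_between_def tK by metis
  have MK: "M \<subseteq> K" using MG(1) closedin_subset tK by blast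
  have "closedin X M" using MG(1) K closedin_trans_full by blast
  moreover have "Ind0_le (subtopology X M) (n - 1)"
    using Mn MK by (simp add: subtopology_subtopology inf.absorb2)
  ultimately show thesis using that MG MK by blast
qed

text \<open>Induction on \<open>n\<close>. A partition \<open>T\<close> of the remainder is
  continued through the pieces \<open>S j\<close> by \<open>glued_partition\<close>. The result is
  again a clopen sum, of the sets \<open>M j\<close> with remainder \<open>T\<close>, so the
  induction hypothesis bounds its dimension.\<close>

lemma Ind0_le_clopen_sum:
  assumes "-1 \<le> n" and norm: "normal_space X"
    and "\<And>j::nat. openin X (S j)" "\<And>j. closedin X (S j)" "\<And>i j. i \<noteq> j \<Longrightarrow> disjnt (S i) (S j)"
    and "\<And>j. Ind0_le (subtopology X (S j)) n"
    and "Ind0_le (subtopology X (topspace X - (\<Union>j. S j))) n"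
  shows "Ind0_le X n"
  using assms
proof (induction n arbitrary: X S rule: int_ge_induct)
  case base
  have "S j = {}" for j using base(5)[of j] base(3)[of j]
    by (metis Ind0_le_minus_one_iff closedin_subset inf.absorb2 topspace_subtopology)
  then show ?case using base(6) by (auto simp: Ind0_le_minus_one_iff)
next
  case (step n)
  note norm = \<open>normal_space X\<close> and Sop = step.prems(2) and Scl = step.prems(3) and Sdis = step.prems(4)
  let ?Z = "topspace X - (\<Union>j. S j)"
  have n1: "0 \<le> n + 1" using step by simp
  show ?case
  proof (rule Ind0_le.partition[OF n1])
    fix A B assume AB: "closedin X A" "closedin X B" "disjnt A B"
    have Zcl: "closedin X ?Z" using Sop by blast
    have "A \<inter> B \<inter> ?Z = {}" using AB by (auto simp: disjnt_iff)
    then obtain T P Q where T: "closedin X T" "T \<subseteq> ?Z" "gdelta_in (subtopology X ?Z) T"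
      and PQ: "openin (subtopology X ?Z) P" "openin (subtopology X ?Z) Q" "disjnt P Q" "?Z - T = P \<union> Q"
         "A \<inter> ?Z \<subseteq> P" "B \<inter> ?Z \<subseteq> Q" and Tn: "Ind0_le (subtopology X T) n"
      using Ind0_le_subspace_partition[OF step.prems(6) n1 Zcl AB(1,2)] by (metis add_diff_cancel_right')
    obtain a b where ab: "\<And>j. closedin X (a j)" "\<And>j. closedin X (b j)" "a 0 = A" "b 0 = B"
      "\<And>j. a j \<subseteq> X interior_of (a (Suc j))" "\<And>j. b j \<subseteq> X interior_of (b (Suc j))"
      "\<And>j. disjnt (a j) (b j)" "?Z \<inter> (\<Union>j. a j) = P" "?Z \<inter> (\<Union>j. b j) = Q"
      using partition_exhaustion[OF norm Zcl AB T(3) PQ] by blast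
    have "\<exists>M G H. gdelta_in (subtopology X (S j)) M \<and> S j - M = G \<union> H \<and> disjnt G H \<and>
       openin (subtopology X (S j)) G \<and> openin (subtopology X (S j)) H \<and> a j \<inter> S j \<subseteq> G \<and> b j \<inter> S j \<subseteq> H
       \<and> Ind0_le (subtopology X M) n" for j
    proof -
      have "a j \<inter> b j \<inter> S j = {}" using ab(7)[of j] by (auto simp: disjnt_iff)
      then obtain M G H where "gdelta_in (subtopology X (S j)) M" "openin (subtopology X (S j)) G"
          "openin (subtopology X (S j)) H" "disjnt G H" "S j - M = G \<union> H"
          "a j \<inter> S j \<subseteq> G" "b j \<inter> S j \<subseteq> H" "Ind0_le (subtopology X M) (n + 1 - 1)"
        using Ind0_le_subspace_partition[OF step.prems(5) n1 Scl ab(1,2)] by metis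
      then show ?thesis by auto
    qed
    then obtain M G H where M: "\<And>j. gdelta_in (subtopology X (S j)) (M j)"
      "\<And>j. S j - M j = G j \<union> H j" "\<And>j. disjnt (G j) (H j)"
      "\<And>j. openin (subtopology X (S j)) (G j)" "\<And>j. openin (subtopology X (S j)) (H j)"
      "\<And>j. a j \<inter> S j \<subseteq> G j" "\<And>j. b j \<inter> S j \<subseteq> H j" and Mn: "\<And>j. Ind0_le (subtopology X (M j)) n"
      by metis
    \<comment> \<open>These sets are clopen, so the gluing can take \<open>W = V\<close>: the annuli
      are exactly the pieces \<open>S j\<close>, and the boundary conditions become vacuous.\<close>
    define V where "V j = topspace X - (\<Union>i<j. S i)" for j :: nat
    have Vop: "openin X (V j)" for j
      unfolding V_def using Scl by (intro openin_diff closedin_Union) auto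
    have Vcl: "closedin X (V j)" for j
      unfolding V_def using Sop by (intro closedin_diff openin_Union) auto
    have K: "S j = V j - V (Suc j)" for j
      using Scl[of j] closedin_subset[of X "S j"] Sdis unfolding V_def
      by (auto simp: lessThan_Suc disjnt_iff) (metis less_irrefl)
    have ZV: "?Z = (\<Inter>j. V j)" unfolding V_def by auto
    have V0: "V 0 = topspace X" unfolding V_def by simp
    define L where "L = T \<union> (\<Union>j. M j)"
    have VV: "V (Suc j) \<subseteq> V j" for j unfolding V_def by auto
    have A0: "closedin X (a 0)" "closedin X (b 0)" using ab by auto
    have bd: "V j - V j \<subseteq> G j" "V (Suc j) - V (Suc j) \<subseteq> G j" for j by auto
    note glue = glued_partition[of X V V ?Z a b T P Q S M G H, OF Vop Vcl order_refl VV V0 ZV ab(5,6) A0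
        T(3) PQ(4,3) ab(8,9) K M bd]
    have L: "gdelta_partition_between X A B L"
       "\<And>j. closedin X (M j)" "\<And>j. openin (subtopology X L) (M j)"
       "\<And>i j. i \<noteq> j \<Longrightarrow> disjnt (M i) (M j)" "L - (\<Union>j. M j) = T"
      using glue unfolding L_def ab(3,4) by blast+
    have Lcl: "closedin X L" using L unfolding gdelta_partition_between_def partition_between_def by blast
    then have tL: "topspace (subtopology X L) = L" using closedin_subset by fastforce
    have LM: "L \<inter> M j = M j" for j unfolding L_def by auto
    have "Ind0_le (subtopology X L) n"
    proof (rule step.IH[of "subtopology X L" M])
      show "normal_space (subtopology X L)" using norm Lcl normal_space_closed_subtopology by blast
      show "closedin (subtopology X L) (M j)" for j using L(2)[of j] LM[of j]
        by (metis closedin_subtopology_Int_closed)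
      show "Ind0_le (subtopology (subtopology X L) (M j)) n" for j using Mn LM by (simp add: subtopology_subtopology)
      show "Ind0_le (subtopology (subtopology X L) (topspace (subtopology X L) - \<Union> (range M))) n"
        using Tn L(5) tL by (simp add: subtopology_subtopology) (metis inf.absorb2 L_def sup_ge1)
    qed (use L in auto)
    then show "\<exists>L. gdelta_partition_between X A B L \<and> Ind0_le (subtopology X L) (n + 1 - 1)"
      using L(1) by auto
  qed
qed

subsection \<open>Ring-like fully closed maps\<close>

lemma compact_space_surjective_image:
  assumes "compact_space X" "continuous_map X Y f" "f ` topspace X = topspace Y"
  shows "compact_space Y"
  using assms by (metis compact_space_def image_compactin)

text \<open>Collects properties that pass to the restriction of \<open>f\<close> over a closed
  subset of \<open>Y\<close>, so that both inductions on dimension can descend to a partition in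
  \<open>Y\<close>. Empty spaces are allowed because a partition may be empty.\<close>

locale ring_like_fully_closed_map =
  fixes X :: "'a topology" and Y :: "'b topology" and f :: "'a \<Rightarrow> 'b"
  assumes comp: "compact_space X" and haus_X: "Hausdorff_space X" and haus_Y: "Hausdorff_space Y"
    and first: "first_countable Y" and cont: "continuous_map X Y f"
    and onto: "f ` topspace X = topspace Y" and ring: "ring_like X Y f" and full: "fully_closed X Y f"
begin

lemma compact_Y: "compact_space Y"
  using comp cont onto by (rule compact_space_surjective_image)

lemma closed: "closed_map X Y f"
  using comp haus_Y cont by (simp add: continuous_imp_closed_map)

lemma normal_X: "normal_space X"
  using comp haus_X compact_Hausdorff_or_regular_imp_normal_space by blast

lemma normal_Y: "normal_space Y"
  using compact_Y haus_Y compact_Hausdorff_or_regular_imp_normal_space by blast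

lemma f_in: "x \<in> topspace X \<Longrightarrow> f x \<in> topspace Y"
  using onto by blast

lemma fiber_ex: "y \<in> topspace Y \<Longrightarrow> \<exists>x\<in>topspace X. f x = y"
  using onto by (metis imageE)

definition preim :: "'b set \<Rightarrow> 'a set"
  where "preim S = {x \<in> topspace X. f x \<in> S}"

lemma preim_iff: "x \<in> preim S \<longleftrightarrow> x \<in> topspace X \<and> f x \<in> S"
  by (simp add: preim_def)

lemma openin_preim: "openin Y S \<Longrightarrow> openin X (preim S)"
  unfolding preim_def using cont openin_continuous_map_preimage by blast

lemma closedin_preim: "closedin Y S \<Longrightarrow> closedin X (preim S)"
  unfolding preim_def using cont closedin_continuous_map_preimage by blast

text \<open>Ring-likeness survives because the frontier in \<open>M\<close> of a trace lies in the
  frontier in \<open>Y\<close>; full closedness survives because closed subsets of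
  \<open>preim M\<close> are closed in \<open>X\<close>.\<close>

lemma restriction:
  assumes M: "closedin Y M"
  shows "ring_like_fully_closed_map (subtopology X (preim M)) (subtopology Y M) f"
proof
  have cl: "closedin X (preim M)" using M by (rule closedin_preim)
  have M': "M \<subseteq> topspace Y" using M closedin_subset by blast
  have t: "topspace (subtopology X (preim M)) = preim M" using cl closedin_subset by fastforce
  show "compact_space (subtopology X (preim M))"
    using comp cl closedin_compact_space compact_space_subtopology by blast
  show "Hausdorff_space (subtopology X (preim M))" "Hausdorff_space (subtopology Y M)"
    using haus_X haus_Y Hausdorff_space_subtopology by blast+
  show "first_countable (subtopology Y M)" using first first_countable_subtopology by blast
  show "continuous_map (subtopology X (preim M)) (subtopology Y M) f"
    using cont t by (auto simp: continuous_map_in_subtopology continuous_map_from_subtopology preim_iff)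
  have "f ` preim M = M"
  proof
    show "M \<subseteq> f ` preim M"
    proof
      fix y assume "y \<in> M"
      then obtain x where "x \<in> topspace X" "f x = y" using M' fiber_ex by blast
      then show "y \<in> f ` preim M" using \<open>y \<in> M\<close> by (auto simp: preim_iff)
    qed
  qed (auto simp: preim_iff)
  then show "f ` topspace (subtopology X (preim M)) = topspace (subtopology Y M)"
    using M' t by auto
  show "ring_like (subtopology X (preim M)) (subtopology Y M) f"
    unfolding ring_like_def
  proof (intro ballI allI impI; elim conjE)
    fix x U V assume x: "x \<in> topspace (subtopology X (preim M))" "openin (subtopology X (preim M)) U" "x \<in> U"
      "openin (subtopology Y M) V" "f x \<in> V"
    then obtain U0 V0 where UV: "openin X U0" "U = U0 \<inter> preim M" "openin Y V0" "V = V0 \<inter> M"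
      unfolding openin_subtopology by blast
    then obtain V1 where V1: "openin Y V1" "f x \<in> V1" "V1 \<subseteq> V0" "{z \<in> topspace X. f z \<in> Y frontier_of V1} \<subseteq> U0"
      using ring x unfolding ring_like_def t preim_iff by (metis IntD1)
    have "(subtopology Y M) frontier_of (M \<inter> V1) \<subseteq> Y frontier_of V1"
      using frontier_of_subtopology_subset[of M Y V1] frontier_of_restrict[of "subtopology Y M" V1]
        frontier_of_subset_subtopology[of Y M V1] M' by (simp add: inf.absorb2 inf.absorb1)
    then have "{z \<in> topspace (subtopology X (preim M)). f z \<in> subtopology Y M frontier_of (M \<inter> V1)} \<subseteq> U"
      using V1(4) UV(2) by (auto simp: t preim_iff)
    moreover have "openin (subtopology Y M) (M \<inter> V1)" using V1(1) by (simp add: openin_subtopology_Int2)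
    moreover have "f x \<in> M" using x(1) t by (simp add: preim_iff)
    ultimately show "\<exists>V'. openin (subtopology Y M) V' \<and> f x \<in> V' \<and> V' \<subseteq> V \<and>
           {z \<in> topspace (subtopology X (preim M)). f z \<in> subtopology Y M frontier_of V'} \<subseteq> U"
      using V1 UV by (intro exI[of _ "M \<inter> V1"]) auto
  qed
  show "fully_closed (subtopology X (preim M)) (subtopology Y M) f"
    unfolding fully_closed_def
  proof (intro allI impI; elim conjE)
    fix F G assume FG: "closedin (subtopology X (preim M)) F" "closedin (subtopology X (preim M)) G" "disjnt F G"
    then have "closedin X F" "closedin X G" using cl closedin_trans_full by blast+
    then have "subtopology Y (f ` F \<inter> f ` G) = discrete_topology (f ` F \<inter> f ` G)"
      using full FG(3) unfolding fully_closed_def by blast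
    moreover have "F \<subseteq> preim M" using FG(1) closedin_subset t by blast
    then have "M \<inter> (f ` F \<inter> f ` G) = f ` F \<inter> f ` G" by (auto simp: preim_iff)
    ultimately show "subtopology (subtopology Y M) (f ` F \<inter> f ` G) = discrete_topology (f ` F \<inter> f ` G)"
      by (simp add: subtopology_subtopology)
  qed
qed

text \<open>As \<open>f\<close> is closed, the intersection is closed in the compact space
  \<open>Y\<close>; being discrete as well, it is finite.\<close>

lemma finite_image_Int:
  assumes "closedin X F" "closedin X G" "disjnt F G"
  shows "finite (f ` F \<inter> f ` G)"
proof -
  have "closedin Y (f ` F \<inter> f ` G)" using assms closed unfolding closed_map_def by blast
  then have "compact_space (subtopology Y (f ` F \<inter> f ` G))"
    using compact_Y closedin_compact_space compact_space_subtopology by blast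
  then show ?thesis
    using assms full compact_space_discrete_topology unfolding fully_closed_def by metis
qed

text \<open>This is \<open>f\<^sup>#(U)\<close>.\<close>
definition small :: "'a set \<Rightarrow> 'b set"
  where "small U = topspace Y - f ` (topspace X - U)"

lemma small_iff: "y \<in> small U \<longleftrightarrow> y \<in> topspace Y \<and> (\<forall>x\<in>topspace X. f x = y \<longrightarrow> x \<in> U)"
  by (auto simp: small_def)

lemma openin_small: "openin X U \<Longrightarrow> openin Y (small U)"
  using closed unfolding small_def closed_map_def by (metis closedin_def openin_closedin_eq openin_diff openin_topspace)

lemma small_subset_image: "small U \<subseteq> f ` U"
proof
  fix y assume "y \<in> small U"
  then obtain x where "x \<in> topspace X" "f x = y" using fiber_ex unfolding small_def by blast
  then show "y \<in> f ` U" using \<open>y \<in> small U\<close> unfolding small_iff by blast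
qed

lemma small_frontier:
  assumes "{x \<in> topspace X. f x \<in> Y frontier_of V} \<subseteq> U"
  shows "Y frontier_of V \<subseteq> small U"
  using assms frontier_of_subset_topspace[of Y V] unfolding small_iff subset_iff by blast

lemma closedin_finite: "finite E \<Longrightarrow> E \<subseteq> topspace Y \<Longrightarrow> closedin Y E"
  using haus_Y Hausdorff_imp_t1_space t1_space_closedin_finite by blast

text \<open>The points of \<open>E\<close> are treated one at a time: ring-likeness is applied at a
  point of \<open>U\<close> in the fiber, and the frontier of a union lies in the union of the
  frontiers.\<close>

lemma ring_neighbourhood:
  assumes "finite E" "E \<subseteq> G" "openin Y G" "openin X U" "E \<subseteq> f ` U"
  obtains V where "openin Y V" "E \<subseteq> V" "Y closure_of V \<subseteq> G" "Y frontier_of V \<subseteq> small U"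
proof -
  have "\<exists>V. openin Y V \<and> E \<subseteq> V \<and> Y closure_of V \<subseteq> G \<and> Y frontier_of V \<subseteq> small U"
    using assms(1,2,5)
  proof (induction E rule: finite_induct)
    case empty
    then show ?case by (intro exI[of _ "{}"]) auto
  next
    case (insert y E)
    then obtain V where V: "openin Y V" "E \<subseteq> V" "Y closure_of V \<subseteq> G" "Y frontier_of V \<subseteq> small U" by auto
    obtain x where x: "x \<in> U" "f x = y" using insert.prems by blast
    have y: "y \<in> topspace Y" using insert.prems assms(3,4) openin_subset by blast
    \<comment> \<open>Ring-likeness controls \<open>V'\<close> but not its closure, so
      \<open>G\<close> is first shrunk to a neighborhood whose closure stays in
      \<open>G\<close>.\<close>
    then obtain G' where G': "openin Y G'" "{y} \<subseteq> G'" "Y closure_of G' \<subseteq> G"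
      using normal_Y closedin_finite[of "{y}"] insert.prems assms(3) unfolding normal_space_alt
      by (metis bot_least finite.emptyI finite.insertI insert_subset)
    have xt: "x \<in> topspace X" using x openin_subset[OF assms(4)] by blast
    then obtain V' where V': "openin Y V'" "y \<in> V'" "V' \<subseteq> G'" "{z \<in> topspace X. f z \<in> Y frontier_of V'} \<subseteq> U"
      using ring x G' assms(4) xt unfolding ring_like_def by (metis insert_subset)
    have "Y closure_of V' \<subseteq> G" using V'(3) G'(3) closure_of_mono by blast
    moreover have "Y frontier_of (V \<union> V') \<subseteq> small U"
      using frontier_of_Un_subset[of Y V V'] V(4) small_frontier[OF V'(4)] by blast
    ultimately show ?case using V V' by (intro exI[of _ "V \<union> V'"]) auto
  qed
  then show thesis using that by blast
qed

text \<open>First countability is used here: in a T1 space, the members of a countable local base at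
  a point that contain the point intersect in it alone.\<close>

lemma gdelta_in_finite:
  assumes "finite E" "E \<subseteq> topspace Y"
  shows "gdelta_in Y E"
  using assms
proof (induction E rule: finite_induct)
  case (insert y E)
  have y: "y \<in> topspace Y" using insert.prems by auto
  obtain \<B> where B': "countable \<B> \<and> (\<forall>V\<in>\<B>. openin Y V) \<and>
      (\<forall>U. openin Y U \<and> y \<in> U \<longrightarrow> (\<exists>V\<in>\<B>. y \<in> V \<and> V \<subseteq> U))"
    using bspec[OF first[unfolded first_countable_def] y] by (rule exE)
  then have B: "countable \<B>" "\<And>V. V \<in> \<B> \<Longrightarrow> openin Y V"
    "\<And>U. openin Y U \<Longrightarrow> y \<in> U \<Longrightarrow> \<exists>V\<in>\<B>. y \<in> V \<and> V \<subseteq> U"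
    by simp_all
  let ?C = "{V \<in> \<B>. y \<in> V}"
  have "z = y" if z: "z \<in> \<Inter> ?C" for z
  proof -
    obtain V where V: "V \<in> \<B>" "y \<in> V" using B(3)[OF openin_topspace y] by blast
    then have "z \<in> V" using z by blast
    then have "z \<in> topspace Y" using openin_subset[OF B(2)[OF V(1)]] by blast
    show "z = y"
    proof (rule ccontr)
      assume "z \<noteq> y"
      have "closedin Y {z}" using closedin_finite[of "{z}"] \<open>z \<in> topspace Y\<close> by simp
      then have "openin Y (topspace Y - {z})" by blast
      then obtain V where "V \<in> \<B>" "y \<in> V" "V \<subseteq> topspace Y - {z}"
        using B(3)[of "topspace Y - {z}"] y \<open>z \<noteq> y\<close> by blast
      then show False using z by blast
    qed
  qed
  then have "{y} = \<Inter> ?C" by blast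
  moreover have "?C \<noteq> {}" using B(3)[OF openin_topspace y] by blast
  moreover have "gdelta_in Y (\<Inter> ?C)" if "?C \<noteq> {}"
    using that B(1) open_imp_gdelta_in[OF B(2)] by (intro gdelta_in_Inter) auto
  ultimately have "gdelta_in Y {y}" by metis
  then show ?case using insert gdelta_in_Un[of Y "{y}" E] by simp
qed simp

subsection \<open>The upper bound\<close>

lemma gdelta_in_preim:
  assumes "gdelta_in Y D"
  shows "gdelta_in X (preim D)"
proof -
  obtain C :: "nat \<Rightarrow> 'b set" where C: "\<And>n. openin Y (C n)" "\<And>n. C (Suc n) \<subseteq> C n" "(\<Inter>n. C n) = D"
    using assms unfolding gdelta_in_descending by blast
  show ?thesis
    unfolding gdelta_in_descending
  proof (intro exI conjI allI)
    show "openin X (preim (C n))" for n using C(1) openin_preim by blast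
    show "preim (C (Suc n)) \<subseteq> preim (C n)" for n using C(2)[of n] by (auto simp: preim_iff)
    show "(\<Inter>n. preim (C n)) = preim D" unfolding C(3)[symmetric] by (auto simp: preim_iff)
  qed
qed

lemma gdelta_in_subtopology_preim:
  assumes "gdelta_in (subtopology Y K) M"
  shows "gdelta_in (subtopology X (preim K)) (preim M)"
proof -
  obtain D where "gdelta_in Y D" "M = D \<inter> K" using assms unfolding gdelta_in_subtopology by blast
  then show ?thesis unfolding gdelta_in_subtopology
    by (intro exI[of _ "preim D"]) (auto simp: gdelta_in_preim preim_iff)
qed

lemma openin_subtopology_preim:
  assumes "openin (subtopology Y K) M"
  shows "openin (subtopology X (preim K)) (preim M)"
proof -
  obtain D where "openin Y D" "M = D \<inter> K" using assms unfolding openin_subtopology by blast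
  then show ?thesis unfolding openin_subtopology
    by (intro exI[of _ "preim D"]) (auto simp: openin_preim preim_iff)
qed

lemma Ind0_le_preim_finite:
  assumes E: "finite E" "E \<subseteq> topspace Y" and m: "-1 \<le> m"
    and fib: "\<And>y. y \<in> E \<Longrightarrow> Ind0_le (subtopology X (preim {y})) m"
  shows "Ind0_le (subtopology X (preim E)) m"
proof -
  obtain e :: "'b \<Rightarrow> nat" where e: "inj_on e E" using finite_imp_inj_to_nat_seg[OF E(1)] by metis
  define S where "S j = preim (E \<inter> e -` {j})" for j
  let ?X = "subtopology X (preim E)"
  have cl: "closedin X (preim E')" if "E' \<subseteq> E" for E'
    using that E finite_subset by (intro closedin_preim closedin_finite) auto
  have t: "topspace ?X = preim E" using closedin_subset[OF cl[of E]] by auto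
  have cl': "closedin ?X (preim E')" if "E' \<subseteq> E" for E'
    using cl[OF that] that by (subst closedin_closed_subtopology[OF cl[of E]]) (auto simp: preim_iff)
  have Scl: "closedin ?X (S j)" for j unfolding S_def by (rule cl') auto
  have Sop: "openin ?X (S j)" for j
  proof -
    have "closedin ?X (preim (E - e -` {j}))" by (rule cl') auto
    then have "openin ?X (topspace ?X - preim (E - e -` {j}))" by blast
    moreover have "topspace ?X - preim (E - e -` {j}) = S j" unfolding t S_def by (auto simp: preim_iff)
    ultimately show ?thesis by simp
  qed
  have emp: "Ind0_le (subtopology X {}) m"
    using Ind0_le_mono[of "subtopology X {}" "-1" m] m by (simp add: Ind0_le_minus_one_iff)
  show ?thesis
  proof (rule Ind0_le_clopen_sum[OF m _ Sop Scl])
    show "normal_space ?X" using normal_X cl[of E] normal_space_closed_subtopology by blast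
    show "disjnt (S i) (S j)" if "i \<noteq> j" for i j using that unfolding S_def by (auto simp: disjnt_iff preim_iff)
    show "Ind0_le (subtopology ?X (S j)) m" for j
    proof (cases "E \<inter> e -` {j} = {}")
      case True
      then have "S j = {}" unfolding S_def by (simp add: preim_def)
      then show ?thesis using emp by (simp add: subtopology_subtopology)
    next
      case False
      then obtain y where y: "y \<in> E" "e y = j" by blast
      then have "E \<inter> e -` {j} = {y}" using e by (auto simp: inj_on_def)
      then have "S j = preim {y}" unfolding S_def by simp
      moreover have "preim E \<inter> preim {y} = preim {y}" using y by (auto simp: preim_iff)
      ultimately show ?thesis using fib[OF y(1)] by (simp add: subtopology_subtopology)
    qed
    have Z: "topspace ?X - (\<Union>j. S j) = {}" unfolding t S_def by (auto simp: preim_iff)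
    show "Ind0_le (subtopology ?X (topspace ?X - (\<Union>j. S j))) m"
      unfolding Z subtopology_subtopology using emp by simp
  qed
qed

text \<open>Iterates \<open>ring_neighbourhood\<close>. Open sets \<open>C n\<close> with
  intersection \<open>E\<close> force the \<open>v j\<close> down to \<open>E\<close>, and the
  finite set \<open>F n - E\<close> can be cut out of the next neighborhood because finite sets are
  closed.\<close>

lemma shrinking_neighbourhoods:
  assumes E: "finite E" "E \<subseteq> topspace Y" and U: "openin X U" "E \<subseteq> f ` U" and F: "\<And>j::nat. finite (F j)"
  obtains v :: "nat \<Rightarrow> 'b set" where "\<And>j. openin Y (v j)" "v 0 = topspace Y" "(\<Inter>j. v j) = E"
    "\<And>j. Y closure_of v (Suc j) \<subseteq> v j" "\<And>j. Y frontier_of v j \<subseteq> small U"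
    "\<And>j. Y closure_of v (Suc j) \<inter> F j \<subseteq> E"
proof -
  obtain C :: "nat \<Rightarrow> 'b set" where C: "\<And>n. openin Y (C n)" "(\<Inter>n. C n) = E"
    using gdelta_in_finite[OF E] unfolding gdelta_in_descending by blast
  define Inv where "Inv = (\<lambda>n v. openin Y v \<and> E \<subseteq> v \<and> Y frontier_of v \<subseteq> small U \<and> (n = (0::nat) \<longrightarrow> v = topspace Y))"
  define Stp where "Stp = (\<lambda>n v v'. Y closure_of v' \<subseteq> v \<inter> C n - (F n - E))"
  have "\<exists>v. \<forall>n. Inv n (v n) \<and> Stp n (v n) (v (Suc n))"
  proof (rule dependent_nat_choice)
    show "\<exists>v. Inv 0 v" unfolding Inv_def using E by (intro exI[of _ "topspace Y"]) auto
  next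
    fix v n assume v: "Inv n v"
    let ?G = "v \<inter> C n - (F n - E) \<inter> topspace Y"
    have "closedin Y ((F n - E) \<inter> topspace Y)" using F by (intro closedin_finite) auto
    then have "openin Y ?G" using v C(1) unfolding Inv_def by blast
    moreover have "E \<subseteq> ?G" using v C(2) unfolding Inv_def by blast
    ultimately obtain v' where v': "openin Y v'" "E \<subseteq> v'" "Y closure_of v' \<subseteq> ?G" "Y frontier_of v' \<subseteq> small U"
      using ring_neighbourhood[OF E(1) _ _ U] by metis
    have "Stp n v v'" using v'(3) closure_of_subset_topspace[of Y v'] unfolding Stp_def by blast
    then show "\<exists>v'. Inv (Suc n) v' \<and> Stp n v v'" using v' unfolding Inv_def by blast
  qed
  then obtain v where v: "\<And>n. Inv n (v n)" "\<And>n. Stp n (v n) (v (Suc n))" by blast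
  have op: "openin Y (v n)" "E \<subseteq> v n" "Y frontier_of v n \<subseteq> small U" and v0: "v 0 = topspace Y" for n
    using v(1)[of n] v(1)[of 0] by (auto simp: Inv_def)
  have st: "Y closure_of v (Suc n) \<subseteq> v n \<inter> C n - (F n - E)" for n
    using v(2)[of n] by (simp add: Stp_def)
  have "v (Suc n) \<subseteq> C n" for n
    using st[of n] closure_of_subset[OF openin_subset[OF op(1)[of "Suc n"]]] by blast
  then have "(\<Inter>j. v j) \<subseteq> (\<Inter>n. C n)" by blast
  then have "(\<Inter>j. v j) = E" using op(2) C(2) by blast
  then show thesis using that[of v] op v0 st by blast
qed

end

text \<open>Induction on \<open>n\<close>. In the step to \<open>n + 1\<close>, the partition
  consists of \<open>T\<close>, of dimension at most \<open>m - 1\<close>, and of clopen sets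
  \<open>preim (M j)\<close>, of dimension at most \<open>n + m\<close> by induction; as
  \<open>n\<close> is at least -1, all fit into the bound \<open>n + m\<close>.\<close>

lemma Ind0_le_of_fibers:
  fixes X :: "'a topology" and Y :: "'b topology"
  assumes "-1 \<le> n" and m: "0 \<le> m" and "ring_like_fully_closed_map X Y f" and "Ind0_le Y n"
    and "\<And>y. y \<in> topspace Y \<Longrightarrow> Ind0_le (subtopology X {x \<in> topspace X. f x = y}) m"
  shows "Ind0_le X (n + m)"
  using assms(1,3-)
proof (induction n arbitrary: X Y rule: int_ge_induct)
  case base
  then interpret ring_like_fully_closed_map X Y f by simp
  have "topspace Y = {}" using base by (simp only: Ind0_le_minus_one_iff)
  then have "topspace X = {}" using f_in by blast
  then show ?case using Ind0_le_mono[of X "-1" "-1 + m"] m by (simp add: Ind0_le_minus_one_iff)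
next
  case (step n)
  then interpret ring_like_fully_closed_map X Y f by simp
  have fib: "Ind0_le (subtopology X (preim {y})) m" if "y \<in> topspace Y" for y
    using step.prems(3)[OF that] by (simp add: preim_def)
  have n1: "0 \<le> n + 1" "0 \<le> n + 1 + m" using step m by auto
  show ?case
  proof (rule Ind0_le.partition[OF n1(2)])
    fix A B assume AB: "closedin X A" "closedin X B" "disjnt A B"
    define E where "E = f ` A \<inter> f ` B"
    have E: "finite E" "E \<subseteq> topspace Y"
      using finite_image_Int[OF AB] closedin_subset[OF AB(1)] f_in unfolding E_def by auto
    define Z where "Z = preim E"
    have Zcl: "closedin X Z" unfolding Z_def using E by (intro closedin_preim closedin_finite)
    have "A \<inter> B \<inter> Z = {}" using AB by (auto simp: disjnt_iff)
    moreover have "Ind0_le (subtopology X Z) m"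
      unfolding Z_def using m by (intro Ind0_le_preim_finite[OF E] fib subsetD[OF E(2)]) simp_all
    ultimately obtain T P Q where T: "closedin X T" "T \<subseteq> Z" "gdelta_in (subtopology X Z) T"
      and PQ: "openin (subtopology X Z) P" "openin (subtopology X Z) Q" "disjnt P Q" "Z - T = P \<union> Q"
        "A \<inter> Z \<subseteq> P" "B \<inter> Z \<subseteq> Q" and Tm: "Ind0_le (subtopology X T) (m - 1)"
      using Ind0_le_subspace_partition[OF _ m Zcl AB(1,2)] by metis
    obtain a b where ab: "\<And>j. closedin X (a j)" "\<And>j. closedin X (b j)" "a 0 = A" "b 0 = B"
      "\<And>j. a j \<subseteq> X interior_of (a (Suc j))" "\<And>j. b j \<subseteq> X interior_of (b (Suc j))"
      "\<And>j. disjnt (a j) (b j)" "Z \<inter> (\<Union>j. a j) = P" "Z \<inter> (\<Union>j. b j) = Q"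
      using partition_exhaustion[OF normal_X Zcl AB T(3) PQ] by blast
    have amono: "a i \<subseteq> a j" if "i \<le> j" for i j
      using lift_Suc_mono_le[of a i j] ab(5) that by (meson interior_of_subset order_trans)
    have bmono: "b i \<subseteq> b j" if "i \<le> j" for i j
      using lift_Suc_mono_le[of b i j] ab(6) that by (meson interior_of_subset order_trans)
    \<comment> \<open>\<open>A\<close> lies in \<open>?U\<close>, so every fiber over
      \<open>E\<close> meets \<open>?U\<close>. Ring-likeness can then put the frontiers of the
      \<open>v j\<close> into \<open>small ?U\<close>, over which whole fibers lie in
      \<open>a (Suc 0)\<close>.\<close>
    let ?U = "X interior_of (a (Suc 0))"
    have "E \<subseteq> f ` ?U" using ab(5)[of 0] unfolding E_def ab(3) by blast
    moreover have "finite (f ` a (Suc j) \<inter> f ` b (Suc j))" for j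
      by (rule finite_image_Int[OF ab(1,2,7)])
    ultimately obtain v :: "nat \<Rightarrow> 'b set" where
      v: "\<And>j. openin Y (v j)" "v 0 = topspace Y" "(\<Inter>j. v j) = E"
        "\<And>j. Y closure_of v (Suc j) \<subseteq> v j" "\<And>j. Y frontier_of v j \<subseteq> small ?U"
      and vF: "\<And>j. Y closure_of v (Suc j) \<inter> (f ` a (Suc j) \<inter> f ` b (Suc j)) \<subseteq> E"
      using shrinking_neighbourhoods[OF E openin_interior_of, of "a (Suc 0)" "\<lambda>j. f ` a (Suc j) \<inter> f ` b (Suc j)"] by metis
    have vcl: "v j \<subseteq> Y closure_of v j" for j using v(1) closure_of_subset openin_subset by metis
    have vfr: "Y closure_of v j - v j = Y frontier_of v j" for j
      using frontier_of_openin[OF v(1)] by simp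
    \<comment> \<open>\<open>a (Suc 0)\<close> is contained in all later \<open>a i\<close> and is
      therefore disjoint from every \<open>b i\<close>; the frontiers can thus be assigned to the
      side of \<open>a\<close>.\<close>
    have frb: "Y frontier_of v j \<inter> f ` b i = {}" for i j
    proof -
      have "False" if "x \<in> b i" "f x \<in> small ?U" for x
      proof -
        have "x \<in> topspace X" using that closedin_subset[OF ab(2)] by blast
        then have "x \<in> a (Suc 0)" using that interior_of_subset unfolding small_iff by fastforce
        then show False using that amono[of "Suc 0" "Suc i"] bmono[of i "Suc i"] ab(7)[of "Suc i"]
          by (auto simp: disjnt_iff)
      qed
      then show ?thesis using v(5)[of j] by blast
    qed
    define k where "k j = Y closure_of v j - v (Suc j)" for j
    have kcl: "closedin Y (k j)" for j unfolding k_def using v(1) by (intro closedin_diff) auto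
    \<comment> \<open>This makes partitions in \<open>Y\<close> possible: the annulus
      \<open>k j\<close> misses \<open>E\<close>, and \<open>f(a j)\<close> and
      \<open>f(b j)\<close> have no common point outside \<open>E\<close> in the closure of
      \<open>v j\<close>. For \<open>j = 0\<close> this is the definition of \<open>E\<close>, later
      it is \<open>vF\<close>.\<close>
    have abk: "f ` a j \<inter> f ` b j \<inter> k j = {}" for j
    proof -
      have "E \<inter> k j = {}" unfolding k_def using v(3) by blast
      moreover have "f ` a j \<inter> f ` b j \<inter> Y closure_of v j \<subseteq> E"
      proof (cases j)
        case 0
        then show ?thesis using ab(3,4) by (auto simp: E_def)
      next
        case (Suc i)
        then show ?thesis using vF[of i] by blast
      qed
      ultimately show ?thesis unfolding k_def by blast
    qed
    \<comment> \<open>The partition is taken in \<open>Y\<close>, where it has dimension at most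
      \<open>n\<close>. Adding both frontiers to the first closed set provides the boundary
      conditions of the gluing, used as \<open>G7\<close> and \<open>G8\<close>.\<close>
    have "\<exists>M G H. closedin Y M \<and> gdelta_in (subtopology Y (k j)) M \<and>
        openin (subtopology Y (k j)) G \<and> openin (subtopology Y (k j)) H \<and> disjnt G H \<and> k j - M = G \<union> H \<and>
        (f ` a j \<union> Y frontier_of v j \<union> Y frontier_of v (Suc j)) \<inter> k j \<subseteq> G \<and> f ` b j \<inter> k j \<subseteq> H \<and>
        Ind0_le (subtopology Y M) n" for j
    proof -
      have "closedin Y (f ` a j \<union> Y frontier_of v j \<union> Y frontier_of v (Suc j))" "closedin Y (f ` b j)"
        using ab(1,2) closed unfolding closed_map_def by (simp_all add: closedin_Un closedin_frontier_of)
      moreover have "(f ` a j \<union> Y frontier_of v j \<union> Y frontier_of v (Suc j)) \<inter> f ` b j \<inter> k j = {}"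
        using abk[of j] frb[of j j] frb[of "Suc j" j] by blast
      moreover have "Ind0_le (subtopology Y (k j)) (n + 1)"
        using step.prems(2) kcl by (rule Ind0_le_closed_subtopology)
      ultimately obtain M G H where "closedin Y M" "gdelta_in (subtopology Y (k j)) M"
        "openin (subtopology Y (k j)) G" "openin (subtopology Y (k j)) H" "disjnt G H" "k j - M = G \<union> H"
        "(f ` a j \<union> Y frontier_of v j \<union> Y frontier_of v (Suc j)) \<inter> k j \<subseteq> G" "f ` b j \<inter> k j \<subseteq> H"
        "Ind0_le (subtopology Y M) (n + 1 - 1)"
        using Ind0_le_subspace_partition[OF _ n1(1) kcl] by metis
      then show ?thesis by auto
    qed
    then obtain M G H where M: "\<And>j. closedin Y (M j)" "\<And>j. gdelta_in (subtopology Y (k j)) (M j)"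
        "\<And>j. openin (subtopology Y (k j)) (G j)" "\<And>j. openin (subtopology Y (k j)) (H j)"
        "\<And>j. disjnt (G j) (H j)" "\<And>j. k j - M j = G j \<union> H j"
      and aG: "\<And>j. (f ` a j \<union> Y frontier_of v j \<union> Y frontier_of v (Suc j)) \<inter> k j \<subseteq> G j"
      and bH: "\<And>j. f ` b j \<inter> k j \<subseteq> H j" and Mn: "\<And>j. Ind0_le (subtopology Y (M j)) n"
      by metis
    define L where "L = T \<union> (\<Union>j. preim (M j))"
    have G1: "openin X (preim (v j))" "closedin X (preim (Y closure_of v j))"
       "preim (v j) \<subseteq> preim (Y closure_of v j)" "preim (Y closure_of v (Suc j)) \<subseteq> preim (v j)" for j
      using vcl[of j] v(4)[of j] by (auto simp: preim_iff intro: openin_preim[OF v(1)] closedin_preim)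
    have G2: "preim (v 0) = topspace X" using v(2) f_in by (auto simp: preim_iff)
    have G3: "Z = (\<Inter>j. preim (v j))" unfolding Z_def v(3)[symmetric] by (auto simp: preim_iff)
    have G4: "preim (k j) = preim (Y closure_of v j) - preim (v (Suc j))" for j
      unfolding k_def by (auto simp: preim_iff)
    have G5: "preim (k j) - preim (M j) = preim (G j) \<union> preim (H j)" "disjnt (preim (G j)) (preim (H j))" for j
      using M(5,6)[of j] by (auto simp: preim_iff disjnt_iff set_eq_iff)
    have G6: "a j \<inter> preim (k j) \<subseteq> preim (G j)" "b j \<inter> preim (k j) \<subseteq> preim (H j)" for j
      using aG[of j] bH[of j] by (auto simp: preim_iff)
    have G7: "preim (Y closure_of v j) - preim (v j) \<subseteq> preim (G j)" for j
    proof
      fix x assume "x \<in> preim (Y closure_of v j) - preim (v j)"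
      then have x: "x \<in> topspace X" "f x \<in> Y closure_of v j - v j" by (auto simp: preim_iff)
      then have "f x \<in> k j" "f x \<in> Y frontier_of v j"
        using vfr[of j] v(4)[of j] vcl[of "Suc j"] unfolding k_def by blast+
      then show "x \<in> preim (G j)" using aG[of j] x by (auto simp: preim_iff)
    qed
    have G8: "preim (Y closure_of v (Suc j)) - preim (v (Suc j)) \<subseteq> preim (G j)" for j
    proof
      fix x assume "x \<in> preim (Y closure_of v (Suc j)) - preim (v (Suc j))"
      then have x: "x \<in> topspace X" "f x \<in> Y closure_of v (Suc j) - v (Suc j)" by (auto simp: preim_iff)
      then have "f x \<in> k j" "f x \<in> Y frontier_of v (Suc j)"
        using vfr[of "Suc j"] v(4)[of j] vcl[of j] unfolding k_def by blast+
      then show "x \<in> preim (G j)" using aG[of j] x by (auto simp: preim_iff)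
    qed
    have A0: "closedin X (a 0)" "closedin X (b 0)" using ab by auto
    note glue = glued_partition[of X "\<lambda>j. preim (v j)" "\<lambda>j. preim (Y closure_of v j)" Z a b T P Q
        "\<lambda>j. preim (k j)" "\<lambda>j. preim (M j)" "\<lambda>j. preim (G j)" "\<lambda>j. preim (H j)",
        OF G1 G2 G3 ab(5,6) A0 T(3) PQ(4,3) ab(8,9) G4 gdelta_in_subtopology_preim[OF M(2)] G5
          openin_subtopology_preim[OF M(3)] openin_subtopology_preim[OF M(4)] G6 G7 G8]
    have L: "gdelta_partition_between X A B L"
       "\<And>j. closedin X (preim (M j))" "\<And>j. openin (subtopology X L) (preim (M j))"
       "\<And>i j. i \<noteq> j \<Longrightarrow> disjnt (preim (M i)) (preim (M j))" "L - (\<Union>j. preim (M j)) = T"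
      using glue unfolding L_def ab(3,4) by blast+
    have Lcl: "closedin X L" using L unfolding gdelta_partition_between_def partition_between_def by blast
    then have tL: "topspace (subtopology X L) = L" using closedin_subset by fastforce
    have LM: "L \<inter> preim (M j) = preim (M j)" for j unfolding L_def by auto
    have LT: "L \<inter> T = T" unfolding L_def by auto
    have "Ind0_le (subtopology X L) (n + m)"
    proof (rule Ind0_le_clopen_sum[where S = "\<lambda>j. preim (M j)"])
      show "-1 \<le> n + m" using step m by simp
      show "normal_space (subtopology X L)" using normal_X Lcl normal_space_closed_subtopology by blast
      show "closedin (subtopology X L) (preim (M j))" for j using L(2)[of j] LM[of j]
        by (metis closedin_subtopology_Int_closed)
      show "Ind0_le (subtopology (subtopology X L) (preim (M j))) (n + m)" for j
      proof -
        have Mt: "M j \<subseteq> topspace Y" using M(1) closedin_subset by blast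
        have pt: "preim (M j) \<subseteq> topspace X" by (auto simp: preim_iff)
        have "Ind0_le (subtopology X (preim (M j))) (n + m)"
        proof (rule step.IH[OF restriction[OF M(1)] Mn])
          fix y assume "y \<in> topspace (subtopology Y (M j))"
          then have y: "y \<in> M j" "y \<in> topspace Y" by auto
          have "preim (M j) \<inter> {x \<in> topspace (subtopology X (preim (M j))). f x = y} = {x \<in> topspace X. f x = y}"
            using y by (auto simp: preim_iff)
          then show "Ind0_le (subtopology (subtopology X (preim (M j)))
              {x \<in> topspace (subtopology X (preim (M j))). f x = y}) m"
            using step.prems(3)[OF y(2)] by (simp only: subtopology_subtopology)
        qed
        then show ?thesis using LM by (simp add: subtopology_subtopology)
      qed
      have "Ind0_le (subtopology X T) (n + m)" using Ind0_le_mono[OF Tm] step by simp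
      then show "Ind0_le (subtopology (subtopology X L) (topspace (subtopology X L) - (\<Union>j. preim (M j)))) (n + m)"
        unfolding tL L(5) by (simp add: subtopology_subtopology LT)
    qed (use L in auto)
    then show "\<exists>L. gdelta_partition_between X A B L \<and> Ind0_le (subtopology X L) (n + 1 + m - 1)"
      using L(1) by auto
  qed
qed

subsection \<open>The lower bound\<close>

context ring_like_fully_closed_map begin

text \<open>The fiber over \<open>z\<close> is compact and covered by an increasing sequence of
  interiors, so one of them contains it.\<close>

lemma small_Union:
  fixes a :: "nat \<Rightarrow> 'a set"
  assumes a: "\<And>j. a j \<subseteq> X interior_of (a (Suc j))" and z: "z \<in> small (\<Union>j. a j)"
  obtains i where "z \<in> small (X interior_of (a i))"
proof -
  have zY: "z \<in> topspace Y" using z by (simp add: small_iff)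
  have "closedin X (preim {z})" using zY by (intro closedin_preim closedin_finite) auto
  then have "compactin X (preim {z})" using comp closedin_compact_space by blast
  moreover have "preim {z} \<subseteq> (\<Union>j. X interior_of (a j))"
    using z a by (fastforce simp: small_iff preim_iff)
  ultimately obtain \<F> where F: "finite \<F>" "\<F> \<subseteq> range (\<lambda>j. X interior_of (a j))" "preim {z} \<subseteq> \<Union>\<F>"
    using compactinD[of X "preim {z}" "range (\<lambda>j. X interior_of (a j))"] openin_interior_of by (metis (no_types, lifting) imageE)
  obtain J where J: "finite J" "\<F> = (\<lambda>j. X interior_of (a j)) ` J"
    using finite_subset_image[OF F(1,2)] by blast
  have amono: "a i \<subseteq> a j" if "i \<le> j" for i j
    using lift_Suc_mono_le[of a i j] a that by (meson interior_of_subset order_trans)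
  obtain i where i: "\<And>j. j \<in> J \<Longrightarrow> j \<le> i" using J(1) by (metis finite_nat_set_iff_bounded_le)
  have "preim {z} \<subseteq> X interior_of (a i)"
    using F(3) J(2) interior_of_mono[OF amono[OF i]] by blast
  then have "z \<in> small (X interior_of (a i))" using zY by (auto simp: small_iff preim_iff)
  then show thesis by (rule that)
qed

text \<open>Points of \<open>S\<close> outside every \<open>N j\<close> have their fibers in
  \<open>L\<close> and may remain in \<open>M\<close>. Each \<open>N j\<close> contains only
  finitely many points of \<open>S\<close>; these are absorbed stage by stage into open sets with
  frontier in \<open>P\<close> or in \<open>Q\<close>.\<close>

lemma push_partition:
  assumes A: "closedin Y A" and B: "closedin Y B"
    and L: "gdelta_partition_between X (preim A) (preim B) L"
  obtains M where "gdelta_partition_between Y A B M" "preim M \<subseteq> L"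
proof -
  obtain U V where Lcl: "closedin X L" "gdelta_in X L" and UV: "openin X U" "openin X V" "disjnt U V"
    "topspace X - L = U \<union> V" "preim A \<subseteq> U" "preim B \<subseteq> V"
    using L unfolding gdelta_partition_between_def partition_between_def by blast
  have ABp: "closedin X (preim A)" "closedin X (preim B)" "disjnt (preim A) (preim B)"
    using A B closedin_preim UV by (auto simp: disjnt_iff)
  \<comment> \<open>Taking \<open>Z\<close> to be the whole space,
    \<open>partition_exhaustion\<close> writes \<open>U\<close> and \<open>V\<close> as unions of
    closed sets, each contained in the interior of the next.\<close>
  have tt: "subtopology X (topspace X) = X" by (simp add: subtopology_topspace)
  have UV': "preim A \<inter> topspace X \<subseteq> U" "preim B \<inter> topspace X \<subseteq> V" using UV(5,6) by blast+
  obtain a b where ab: "\<And>j. closedin X (a j)" "\<And>j. closedin X (b j)" "a 0 = preim A" "b 0 = preim B"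
      "\<And>j. a j \<subseteq> X interior_of (a (Suc j))" "\<And>j. b j \<subseteq> X interior_of (b (Suc j))"
      "\<And>j. disjnt (a j) (b j)" "topspace X \<inter> (\<Union>j. a j) = U" "topspace X \<inter> (\<Union>j. b j) = V"
    by (rule partition_exhaustion[OF normal_X closedin_topspace ABp, unfolded tt, OF Lcl(2) UV(1-4) UV'])
      (rule that; assumption)
  have aU: "(\<Union>j. a j) = U" "(\<Union>j. b j) = V"
    using ab(8,9) closedin_subset[OF ab(1)] closedin_subset[OF ab(2)] by blast+
  define P where "P = small U"
  define Q where "Q = small V"
  define S where "S = topspace Y - P - Q"
  define N where "N j = f ` a j \<union> f ` b j" for j
  have Pop: "openin Y P" and Qop: "openin Y Q" unfolding P_def Q_def using UV openin_small by blast+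
  have PQ: "P \<inter> Q = {}"
    using UV(3) fiber_ex unfolding P_def Q_def small_iff disjnt_iff set_eq_iff by (metis Int_iff empty_iff small_iff)
  have Ncl: "closedin Y (N j)" for j
    using ab(1,2) closed unfolding N_def closed_map_def by blast
  have amono: "a i \<subseteq> a j" if "i \<le> j" for i j
    using lift_Suc_mono_le[of a i j] ab(5) that by (meson interior_of_subset order_trans)
  have bmono: "b i \<subseteq> b j" if "i \<le> j" for i j
    using lift_Suc_mono_le[of b i j] ab(6) that by (meson interior_of_subset order_trans)
  have Nmono: "N i \<subseteq> N j" if "i \<le> j" for i j
    using amono[OF that] bmono[OF that] unfolding N_def by blast
  have AP: "A \<subseteq> P" "B \<subseteq> Q"
    using UV(5,6) closedin_subset[OF A] closedin_subset[OF B] unfolding P_def Q_def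
    by (auto simp: small_iff preim_iff subset_iff)
  have AN: "A \<subseteq> N 0" "B \<subseteq> N 0"
  proof -
    have "f ` preim R = R" if "closedin Y R" for R
      using fiber_ex closedin_subset[OF that] by (force simp: preim_iff)
    then show "A \<subseteq> N 0" "B \<subseteq> N 0" unfolding N_def ab(3,4) using A B by blast+
  qed
  have N0: "S \<inter> N 0 = {}"
    using AP unfolding N_def ab(3,4) S_def by (auto simp: preim_iff)
  \<comment> \<open>A point of \<open>f(a j)\<close> outside \<open>small U\<close> also lies in the
    image of \<open>topspace X - U\<close>, which is closed and disjoint from \<open>a j\<close>;
    full closedness leaves finitely many such points. The same holds for \<open>b j\<close> and
    \<open>V\<close>.\<close>
  have Sfin: "finite (S \<inter> N j)" for j
  proof -
    have cl: "closedin X (topspace X - U)" "closedin X (topspace X - V)" using UV by blast+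
    have d: "disjnt (a j) (topspace X - U)" "disjnt (b j) (topspace X - V)"
      using aU by (auto simp: disjnt_iff)
    have "S \<inter> N j \<subseteq> (f ` a j \<inter> f ` (topspace X - U)) \<union> (f ` b j \<inter> f ` (topspace X - V))"
      unfolding S_def N_def P_def Q_def small_def by blast
    then show ?thesis
      using finite_image_Int[OF ab(1) cl(1) d(1)] finite_image_Int[OF ab(2) cl(2) d(2)]
      by (meson finite_UnI finite_subset)
  qed
  have clop: "Y closure_of D = D \<union> Y frontier_of D" if "openin Y D" for D
    using frontier_of_openin[OF that] closure_of_subset[OF openin_subset[OF that]] by blast
  define Inv where "Inv = (\<lambda>n (D, D'). openin Y D \<and> openin Y D' \<and> Y closure_of D \<inter> Y closure_of D' = {} \<and>
     Y frontier_of D \<subseteq> P \<and> Y frontier_of D' \<subseteq> Q \<and> S \<inter> N n \<subseteq> D \<union> D' \<and> (n = 0 \<longrightarrow> D = {} \<and> D' = {}))"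
  \<comment> \<open>Stage \<open>n + 1\<close> adds nothing inside \<open>N n\<close>, and the \<open>N n\<close> contain open neighborhoods of all
    points of \<open>P \<union> Q\<close>; so the increasing unions \<open>C\<close>, \<open>D\<close> below are locally attained there.\<close>
  define Stp where "Stp = (\<lambda>n (D::'b set, D'::'b set) (D1, D1'). D \<subseteq> D1 \<and> D' \<subseteq> D1' \<and> D1 \<inter> N n \<subseteq> D \<and> D1' \<inter> N n \<subseteq> D')"
  have "\<exists>g. \<forall>n. Inv n (g n) \<and> Stp n (g n) (g (Suc n))"
  proof (rule dependent_nat_choice)
    show "\<exists>x. Inv 0 x" unfolding Inv_def using N0 by (intro exI[of _ "({},{})"]) auto
  next
    fix x n assume "Inv n x"
    then obtain D D' where x: "x = (D, D')" and D: "openin Y D" "openin Y D'" "Y closure_of D \<inter> Y closure_of D' = {}"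
      "Y frontier_of D \<subseteq> P" "Y frontier_of D' \<subseteq> Q" "S \<inter> N n \<subseteq> D \<union> D'"
      unfolding Inv_def by (cases x) auto
    \<comment> \<open>\<open>E\<close> holds the points still to be absorbed. A neighborhood with
      frontier in \<open>small U\<close> requires a fiber meeting \<open>U\<close>, which gives
      \<open>E1\<close>; a point of \<open>E2\<close> lies in \<open>N (Suc n)\<close>, so its fiber
      meets \<open>V\<close>.\<close>
    define E where "E = S \<inter> N (Suc n) - (D \<union> D')"
    define E1 where "E1 = E \<inter> f ` U"
    define E2 where "E2 = E - f ` U"
    define R where "R = topspace Y - (Y closure_of D \<union> Y closure_of D' \<union> N n)"
    have fin: "finite E1" "finite E2" unfolding E1_def E2_def E_def using Sfin by auto
    have St: "S \<subseteq> topspace Y" unfolding S_def by auto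
    \<comment> \<open>Points of \<open>S\<close> lie on no frontier, since the frontiers are in
      \<open>P\<close> or \<open>Q\<close>, and those in \<open>N n\<close> are already in
      \<open>D\<close> or \<open>D'\<close>.\<close>
    have ER: "E \<subseteq> R"
      using D(4,5,6) St unfolding E_def R_def clop[OF D(1)] clop[OF D(2)] S_def by blast
    have "openin Y R" unfolding R_def using Ncl by (intro openin_diff closedin_Un) auto
    moreover have "closedin Y E2"
      using fin(2) St unfolding E2_def E_def by (intro closedin_finite) auto
    ultimately have RE: "openin Y (R - E2)" by blast
    have "E1 \<subseteq> R - E2" "E1 \<subseteq> f ` U" using ER unfolding E1_def E2_def by auto
    then obtain V1 where V1: "openin Y V1" "E1 \<subseteq> V1" "Y closure_of V1 \<subseteq> R - E2" "Y frontier_of V1 \<subseteq> small U"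
      using ring_neighbourhood[OF fin(1) _ RE UV(1)] by metis
    have RV: "openin Y (R - Y closure_of V1)" using \<open>openin Y R\<close> by (intro openin_diff) auto
    have "N j \<subseteq> f ` U \<union> f ` V" for j unfolding N_def aU[symmetric] by blast
    then have "E2 \<subseteq> R - Y closure_of V1" "E2 \<subseteq> f ` V" using ER V1(3) unfolding E2_def E_def by blast+
    then obtain V2 where V2: "openin Y V2" "E2 \<subseteq> V2" "Y closure_of V2 \<subseteq> R - Y closure_of V1" "Y frontier_of V2 \<subseteq> small V"
      using ring_neighbourhood[OF fin(2) _ RV UV(2)] by metis
    have VR: "V1 \<subseteq> R" "V2 \<subseteq> R" using V1(3) V2(3) clop[OF V1(1)] clop[OF V2(1)] by blast+
    have "Inv (Suc n) (D \<union> V1, D' \<union> V2)"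
      unfolding Inv_def prod.case
    proof (intro conjI)
      show "openin Y (D \<union> V1)" "openin Y (D' \<union> V2)" using D V1 V2 by blast+
      show "Y closure_of (D \<union> V1) \<inter> Y closure_of (D' \<union> V2) = {}"
        using D(3) V1(3) V2(3) unfolding R_def by auto
      show "Y frontier_of (D \<union> V1) \<subseteq> P" using frontier_of_Un_subset[of Y D V1] D(4) V1(4) unfolding P_def by blast
      show "Y frontier_of (D' \<union> V2) \<subseteq> Q" using frontier_of_Un_subset[of Y D' V2] D(5) V2(4) unfolding Q_def by blast
      show "S \<inter> N (Suc n) \<subseteq> D \<union> V1 \<union> (D' \<union> V2)" using V1(2) V2(2) unfolding E1_def E2_def E_def by blast
    qed simp
    moreover have "Stp n x (D \<union> V1, D' \<union> V2)" unfolding Stp_def x prod.case using VR unfolding R_def by blast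
    ultimately show "\<exists>y. Inv (Suc n) y \<and> Stp n x y" by blast
  qed
  then obtain g where g: "\<And>n. Inv n (g n)" "\<And>n. Stp n (g n) (g (Suc n))" by blast
  define c where "c n = fst (g n)" for n
  define d where "d n = snd (g n)" for n
  have I: "openin Y (c n)" "openin Y (d n)" "Y closure_of c n \<inter> Y closure_of d n = {}"
     "Y frontier_of c n \<subseteq> P" "Y frontier_of d n \<subseteq> Q" "S \<inter> N n \<subseteq> c n \<union> d n" for n
    using g(1)[of n] by (auto simp: Inv_def c_def d_def split: prod.splits)
  have 0: "c 0 = {}" "d 0 = {}" using g(1)[of 0] by (auto simp: Inv_def c_def d_def split: prod.splits)
  have st: "c n \<subseteq> c (Suc n)" "d n \<subseteq> d (Suc n)" "c (Suc n) \<inter> N n \<subseteq> c n" "d (Suc n) \<inter> N n \<subseteq> d n" for n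
    using g(2)[of n] by (auto simp: Stp_def c_def d_def split: prod.splits)
  have cm: "c i \<subseteq> c j" "d i \<subseteq> d j" if "i \<le> j" for i j
    using lift_Suc_mono_le[of c i j] lift_Suc_mono_le[of d i j] st(1,2) that by blast+
  have cN: "c j \<inter> N i \<subseteq> c i \<and> d j \<inter> N i \<subseteq> d i" for i j
  proof (cases "i \<le> j")
    case True
    then show ?thesis
    proof (induction j rule: dec_induct)
      case (step j)
      then show ?case using st(3,4)[of j] Nmono[of i j] by blast
    qed auto
  next
    case False
    then show ?thesis using cm[of j i] by auto
  qed
  define C where "C = (\<Union>j. c j)"
  define D where "D = (\<Union>j. d j)"
  have CD: "openin Y C" "openin Y D" unfolding C_def D_def using I by blast+
  have CDdis: "C \<inter> D = {}"
  proof -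
    have "c i \<inter> d j = {}" for i j
    proof -
      have "c (max i j) \<inter> d (max i j) = {}"
        using I(3)[of "max i j"] clop[OF I(1)] clop[OF I(2)] by blast
      then show ?thesis using cm(1)[of i "max i j"] cm(2)[of j "max i j"] by auto
    qed
    then show ?thesis unfolding C_def D_def by blast
  qed
  have CDcl: "C \<inter> Y closure_of D = {}" "D \<inter> Y closure_of C = {}"
    using CD CDdis openin_Int_closure_of_eq_empty[of Y C D] openin_Int_closure_of_eq_empty[of Y D C] by (auto simp: Int_commute)
  have Ccl: "C \<subseteq> Y closure_of C" "D \<subseteq> Y closure_of D"
    using CD closure_of_subset openin_subset by metis+
  have loc: "\<exists>i. (z \<in> Y closure_of C \<longrightarrow> z \<in> Y closure_of (c i)) \<and> (z \<in> Y closure_of D \<longrightarrow> z \<in> Y closure_of (d i))"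
    if z: "z \<in> P \<union> Q" for z
  proof -
    obtain i W where W: "openin Y W" "z \<in> W" "W \<subseteq> N i"
    proof (cases "z \<in> P")
      case True
      then obtain i where i: "z \<in> small (X interior_of (a i))" using small_Union[of a, OF ab(5)] True unfolding P_def aU by metis
      have "small (X interior_of (a i)) \<subseteq> N i"
        using small_subset_image[of "X interior_of (a i)"] interior_of_subset[of X "a i"] unfolding N_def by blast
      then show ?thesis using that[OF openin_small[OF openin_interior_of] i] by blast
    next
      case False
      then have "z \<in> small (\<Union>j. b j)" using z unfolding Q_def aU by blast
      then obtain i where i: "z \<in> small (X interior_of (b i))" using small_Union[of b, OF ab(6)] by metis
      have "small (X interior_of (b i)) \<subseteq> N i"
        using small_subset_image[of "X interior_of (b i)"] interior_of_subset[of X "b i"] unfolding N_def by blast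
      then show ?thesis using that[OF openin_small[OF openin_interior_of] i] by blast
    qed
    have "W \<inter> C \<subseteq> c i" "W \<inter> D \<subseteq> d i" using W(3) cN unfolding C_def D_def by blast+
    then show ?thesis
      using openin_Int_closure_of_subset[OF W(1), of C] openin_Int_closure_of_subset[OF W(1), of D] W(2)
        closure_of_mono[of "W \<inter> C" "c i" Y] closure_of_mono[of "W \<inter> D" "d i" Y] by blast
  qed
  \<comment> \<open>By \<open>loc\<close> the point is in the closure of a single
    \<open>d i\<close>; the frontier of \<open>d i\<close> lies in \<open>Q\<close>, so the point is
    in \<open>d i\<close> itself.\<close>
  have locP: "z \<in> D" if z: "z \<in> P" "z \<in> Y closure_of D" for z
  proof -
    obtain i where "z \<in> Y closure_of (d i)" using loc z by blast
    then show ?thesis using z(1) PQ I(5)[of i] unfolding clop[OF I(2)] D_def by blast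
  qed
  have locQ: "z \<in> C" if z: "z \<in> Q" "z \<in> Y closure_of C" for z
  proof -
    obtain i where "z \<in> Y closure_of (c i)" using loc z by blast
    then show ?thesis using z(1) PQ I(4)[of i] unfolding clop[OF I(1)] C_def by blast
  qed
  \<comment> \<open>Removing the closures makes the two sides disjoint. By \<open>locP\<close> and
    \<open>locQ\<close>, every removed point belongs to the other side, so the union is still that
    of \<open>P\<close>, \<open>Q\<close>, \<open>C\<close> and \<open>D\<close>.\<close>
  define P' where "P' = (P \<union> C) - Y closure_of D"
  define Q' where "Q' = (Q \<union> D) - Y closure_of C"
  define M where "M = topspace Y - (P' \<union> Q')"
  have op: "openin Y P'" "openin Y Q'" unfolding P'_def Q'_def using Pop Qop CD by (auto intro!: openin_diff openin_Un)
  have dis: "disjnt P' Q'" unfolding P'_def Q'_def disjnt_iff using PQ Ccl by blast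
  have un: "P' \<union> Q' = P \<union> Q \<union> C \<union> D"
    using locP locQ CDcl unfolding P'_def Q'_def by blast
  have Mt: "topspace Y - M = P' \<union> Q'" unfolding M_def using openin_subset[OF op(1)] openin_subset[OF op(2)] by blast
  have Mcl: "closedin Y M" unfolding M_def using op by blast
  have "A \<subseteq> P'"
  proof
    fix z assume z: "z \<in> A"
    \<comment> \<open>\<open>A\<close> lies in \<open>N 0\<close>, where no stage adds anything to
      the empty \<open>d 0\<close>.\<close>
    have "z \<notin> D" using z AN(1) cN[of _ 0] 0 unfolding D_def by blast
    then show "z \<in> P'" using z AP locP unfolding P'_def by blast
  qed
  moreover have "B \<subseteq> Q'"
  proof
    fix z assume z: "z \<in> B"
    have "z \<notin> C" using z AN(2) cN[of _ 0] 0 unfolding C_def by blast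
    then show "z \<in> Q'" using z AP locQ unfolding Q'_def by blast
  qed
  moreover have "gdelta_in Y M"
  proof -
    \<comment> \<open>A countable union of closed sets that equals the complement of
      \<open>M\<close>. It does not exceed the complement because \<open>S\<close> meets
      \<open>N j\<close> only inside \<open>c j\<close> and \<open>d j\<close>, whose frontiers lie
      in \<open>P\<close> and \<open>Q\<close>.\<close>
    let ?F = "(\<Union>j. N j) \<union> (\<Union>j. Y closure_of (c j)) \<union> (\<Union>j. Y closure_of (d j))"
    have "f ` U = (\<Union>j. f ` a j)" "f ` V = (\<Union>j. f ` b j)" unfolding aU[symmetric] by (simp_all add: image_UN)
    then have fUV: "f ` U \<subseteq> (\<Union>j. N j)" "f ` V \<subseteq> (\<Union>j. N j)" unfolding N_def by auto
    have PN: "P \<subseteq> (\<Union>j. N j)" "Q \<subseteq> (\<Union>j. N j)"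
      using order_trans[OF small_subset_image fUV(1)] order_trans[OF small_subset_image fUV(2)]
      unfolding P_def Q_def by simp_all
    have CF: "C \<subseteq> (\<Union>j. Y closure_of (c j))" "D \<subseteq> (\<Union>j. Y closure_of (d j))"
      unfolding C_def D_def clop[OF I(1)] clop[OF I(2)] by auto
    have "N j \<subseteq> P \<union> Q \<union> C \<union> D" for j
    proof -
      have "c j \<subseteq> C" "d j \<subseteq> D" unfolding C_def D_def by auto
      then show ?thesis using I(6)[of j] closedin_subset[OF Ncl[of j]] unfolding S_def by auto
    qed
    moreover have "Y closure_of (c j) \<subseteq> P \<union> C" "Y closure_of (d j) \<subseteq> Q \<union> D" for j
      using I(4,5)[of j] unfolding clop[OF I(1)] clop[OF I(2)] C_def D_def by auto
    ultimately have "?F \<subseteq> P \<union> Q \<union> C \<union> D" by fast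
    moreover have "P \<union> Q \<union> C \<union> D \<subseteq> ?F" using PN CF by (simp only: Un_subset_iff le_supI1 le_supI2 simp_thms)
    ultimately have "topspace Y - M = ?F" unfolding Mt un by (rule equalityI[rotated])
    moreover have "fsigma_in Y ?F"
      using Ncl by (intro fsigma_in_Un fsigma_in_Union) (auto intro: closed_imp_fsigma_in)
    ultimately have "fsigma_in Y (topspace Y - M)" by simp
    then show ?thesis using closedin_subset[OF Mcl] gdelta_in_fsigma_in by blast
  qed
  ultimately have "gdelta_partition_between Y A B M"
    unfolding gdelta_partition_between_def partition_between_def using Mcl op dis Mt by (intro conjI exI[of _ P'] exI[of _ Q'])
  moreover have "preim M \<subseteq> L"
  proof
    fix x assume "x \<in> preim M"
    then have x: "x \<in> topspace X" "f x \<in> topspace Y" "f x \<notin> P \<union> Q \<union> C \<union> D"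
      unfolding M_def un by (auto simp: preim_iff)
    show "x \<in> L"
    proof (rule ccontr)
      assume "x \<notin> L"
      then have "x \<in> (\<Union>j. a j) \<union> (\<Union>j. b j)" using x UV(4) unfolding aU by blast
      then obtain j where "f x \<in> N j" unfolding N_def by blast
      then show False using x I(6)[of j] unfolding S_def C_def D_def by blast
    qed
  qed
  ultimately show thesis using that by blast
qed

end

text \<open>Induction on \<open>n\<close>. A partition \<open>L\<close> between the preimages of
  \<open>A\<close> and \<open>B\<close> is pushed down to \<open>M\<close>; as
  \<open>preim M\<close> is closed in \<open>L\<close>, its dimension drops with that of
  \<open>L\<close>, while the fibers over \<open>M\<close> are unchanged.\<close>

lemma Ind0_le_base_of_fibers:
  fixes X :: "'a topology" and Y :: "'b topology"
  assumes "ring_like_fully_closed_map X Y f" and "Ind0_le X n" and "topspace Y \<noteq> {}"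
    and "\<And>y. y \<in> topspace Y \<Longrightarrow> \<not> Ind0_le (subtopology X {x \<in> topspace X. f x = y}) (m - 1)"
  shows "Ind0_le Y (n - m)"
  using Ind0_le_ge[OF assms(2)] assms
proof (induction n arbitrary: X Y rule: int_ge_induct)
  case base
  then interpret ring_like_fully_closed_map X Y f by simp
  show ?case using base fiber_ex by (auto simp only: Ind0_le_minus_one_iff)
next
  case (step n)
  then interpret ring_like_fully_closed_map X Y f by simp
  have fib: "\<not> Ind0_le (subtopology X (preim {y})) (m - 1)" if "y \<in> topspace Y" for y
    using step.prems(4)[OF that] by (simp add: preim_def)
  obtain y where y: "y \<in> topspace Y" using step.prems(3) by blast
  have "closedin X (preim {y})" using y by (intro closedin_preim closedin_finite) auto
  then have "Ind0_le (subtopology X (preim {y})) (n + 1)"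
    using step.prems(2) Ind0_le_closed_subtopology by blast
  \<comment> \<open>A fiber is closed in \<open>X\<close>, so \<open>n + 1\<close> bounds its
    dimension while \<open>m - 1\<close> does not. The inequality also settles the case of empty
    \<open>M\<close>, where -1 must be at most \<open>n - m\<close>.\<close>
  then have nm: "0 \<le> n + 1 - m" using fib[OF y] Ind0_le_mono[of _ "n + 1" "m - 1"] by force
  show ?case
  proof (rule Ind0_le.partition[OF nm])
    fix A B assume AB: "closedin Y A" "closedin Y B" "disjnt A B"
    then have "closedin X (preim A)" "closedin X (preim B)" "disjnt (preim A) (preim B)"
      using closedin_preim by (auto simp: disjnt_iff preim_iff)
    then obtain L where L: "gdelta_partition_between X (preim A) (preim B) L"
      and Ln: "Ind0_le (subtopology X L) (n + 1 - 1)"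
      using step.prems(2) step.hyps Ind0_le_iff[of "n + 1" X] by auto
    obtain M where M: "gdelta_partition_between Y A B M" "preim M \<subseteq> L" using push_partition[OF AB(1,2) L] .
    have Mcl: "closedin Y M" using M unfolding gdelta_partition_between_def partition_between_def by blast
    have pt: "L \<inter> preim M = preim M" using M by auto
    have "closedin (subtopology X L) (preim M)"
      using closedin_preim[OF Mcl] M(2) by (metis closedin_subset_topspace)
    then have Mn: "Ind0_le (subtopology X (preim M)) n"
      using Ind0_le_closed_subtopology[OF Ln] by (fastforce simp add: subtopology_subtopology pt)
    have "Ind0_le (subtopology Y M) (n - m)"
    proof (cases "M = {}")
      case True
      then show ?thesis
        using Ind0_le_mono[of "subtopology Y M" "-1" "n - m"] nm by (simp add: Ind0_le_minus_one_iff)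
    next
      case False
      show ?thesis
      proof (rule step.IH[OF restriction[OF Mcl] Mn])
        show "topspace (subtopology Y M) \<noteq> {}" using False closedin_subset[OF Mcl] by auto
        fix y assume "y \<in> topspace (subtopology Y M)"
        then have y: "y \<in> M" "y \<in> topspace Y" by auto
        have "preim M \<inter> {x \<in> topspace (subtopology X (preim M)). f x = y} = {x \<in> topspace X. f x = y}"
          using y by (auto simp: preim_iff)
        then show "\<not> Ind0_le (subtopology (subtopology X (preim M))
            {x \<in> topspace (subtopology X (preim M)). f x = y}) (m - 1)"
          using step.prems(4)[OF y(2)] by (simp only: subtopology_subtopology not_False_eq_True)
      qed
    qed
    then show "\<exists>L. gdelta_partition_between Y A B L \<and> Ind0_le (subtopology Y L) (n + 1 - m - 1)"
      using M(1) by (intro exI[of _ M]) (simp add: algebra_simps)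
  qed
qed

section \<open>From the bounds \<open>Ind0_le\<close> to the values of \<open>Ind0\<close>\<close>

lemma Ind0_eq_infinity_or_of_int: "Ind0 X = \<infinity> \<or> (\<exists>n. Ind0 X = ereal (of_int n))"
proof (cases "Ind0 X = \<infinity>")
  case False
  then obtain m where m: "Ind0_le X m" using Ind0_eq_infinity_iff by blast
  show ?thesis
  proof (rule ccontr)
    assume n: "\<not> ?thesis"
    \<comment> \<open>If no integer were the value, every bound could be lowered by one, eventually
      below -1.\<close>
    have "Ind0_le X (m - int k)" for k
    proof (induction k)
      case (Suc k)
      then have "Ind0_le X (m - int k - 1)" using n Ind0_eq_iff by blast
      then show ?case by (simp add: algebra_simps)
    qed (use m in simp)
    from Ind0_le_ge[OF this[of "nat (m + 2)"]] Ind0_le_ge[OF m] show False by simp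
  qed
qed simp

theorem theorem2p12:
  fixes X :: "'a topology" and Y :: "'b topology" and f :: "'a \<Rightarrow> 'b"
  assumes "compact_space X" and "Hausdorff_space X" and "topspace X \<noteq> {}"
    and "regular_space Y" and "t1_space Y" and "first_countable Y"
    and "continuous_map X Y f" and "closed_map X Y f" and "f ` topspace X = topspace Y"
    and "ring_like X Y f" and "fully_closed X Y f"
    and "\<And>y. y \<in> topspace Y \<Longrightarrow>
           Ind0 (subtopology X {x \<in> topspace X. f x = y}) = Ind0_map X Y f"
  shows "Ind0 X = Ind0 Y + Ind0_map X Y f"
proof -
  have loc: "ring_like_fully_closed_map X Y f"
    using assms regular_t1_imp_Hausdorff_space by unfold_locales auto
  then interpret ring_like_fully_closed_map X Y f .
  obtain x where x: "x \<in> topspace X" using assms(3) by blast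
  let ?F = "\<lambda>y. subtopology X {x \<in> topspace X. f x = y}"
  note fib = assms(12)
  have y: "f x \<in> topspace Y" using x f_in by blast
  have Yne: "topspace Y \<noteq> {}" using y by blast
  have Ynot: "Ind0 Y \<noteq> -\<infinity>"
    using Ind0_eq_infinity_or_of_int[of Y] by auto
  have clF: "closedin X {z \<in> topspace X. f z = f x}"
    using y closedin_preim[OF closedin_finite[of "{f x}"]] by (simp add: preim_def)
  show ?thesis
  proof (cases "Ind0_map X Y f = \<infinity>")
    case True
    then have "\<not> Ind0_le (?F (f x)) n" for n using fib[OF y] Ind0_eq_infinity_iff by metis
    \<comment> \<open>Any bound for \<open>X\<close> would also bound the closed fiber over
      \<open>f x\<close>.\<close>
    then have "Ind0 X = \<infinity>" using Ind0_le_closed_subtopology[OF _ clF] Ind0_eq_infinity_iff by metis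
    then show ?thesis using True Ynot by simp
  next
    case False
    then obtain m where m: "Ind0_map X Y f = ereal (of_int m)"
      using fib[OF y] Ind0_eq_infinity_or_of_int[of "?F (f x)"] by auto
    have mle: "Ind0_le (?F z) m" "\<not> Ind0_le (?F z) (m - 1)" if "z \<in> topspace Y" for z
      using fib[OF that] m Ind0_eq_iff[of "?F z" m] by auto
    have "m \<ge> -1" using mle(1)[OF y] Ind0_le_ge by blast
    moreover have "m \<noteq> -1"
      using mle(1)[OF y] x by (auto simp: Ind0_le_minus_one_iff)
    ultimately have m0: "0 \<le> m" by linarith
    \<comment> \<open>The two inductions combined: bounds for \<open>X\<close> and for
      \<open>Y\<close> correspond under a shift by \<open>m\<close>, which settles finite and
      infinite values alike.\<close>
    have iff: "Ind0_le X k \<longleftrightarrow> Ind0_le Y (k - m)" for k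
    proof
      show "Ind0_le Y (k - m)" if "Ind0_le X k"
        using Ind0_le_base_of_fibers[OF loc that Yne mle(2)] by blast
      show "Ind0_le X k" if "Ind0_le Y (k - m)"
        using Ind0_le_of_fibers[OF Ind0_le_ge[OF that] m0 loc that mle(1)] by simp
    qed
    show ?thesis
    proof (cases "Ind0 Y = \<infinity>")
      case True
      then have "Ind0 X = \<infinity>" using iff by (simp add: Ind0_eq_infinity_iff)
      then show ?thesis using True m by simp
    next
      case False
      then obtain n where n: "Ind0 Y = ereal (of_int n)" using Ind0_eq_infinity_or_of_int by blast
      then have "Ind0 X = ereal (of_int (n + m))"
        unfolding Ind0_eq_iff iff by (simp add: algebra_simps)
      then show ?thesis using n m by simp
    qed
  qed
qed

end
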